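(* Let $\boldsymbol s=(s_1,s_2)\in S_{1|1}$ and let $\tilde{\boldsymbol s}=(s_2,s_1)$ be the other parity sequence in $S_{1|1}$. Let $\boldsymbol\zeta^{\boldsymbol s}=(\zeta_1^{\boldsymbol s}(u),\zeta_2^{\boldsymbol s}(u))$ with $\zeta_1^{\boldsymbol s}(u),\zeta_2^{\boldsymbol s}(u)\in 1+u^{-1}\mathbb C[[u^{-1}]]$ be such that the irreducible $\mathrm Y(\mathfrak{gl}_{1|1}^{\boldsymbol s})$-module $L(\boldsymbol\zeta^{\boldsymbol s})$ generated by a highest $\ell^{\boldsymbol s}$-weight vector $v^{\boldsymbol s}$ of $\ell^{\boldsymbol s}$-weight $\boldsymbol\zeta^{\boldsymbol s}$ is finite-dimensional, and write $$\frac{\zeta_1^{\boldsymbol s}(u)}{\zeta_2^{\boldsymbol s}(u)}=\frac{\varphi^{\boldsymbol s}(u)}{\psi^{\boldsymbol s}(u)},$$ where $\varphi^{\boldsymbol s}(u),\psi^{\boldsymbol s}(u)$ are relatively prime monic polynomials in $u$ of the same degree $k$. Then the vector $v^{\tilde{\boldsymbol s}}:=f_1^{\boldsymbol s}\cdots f_k^{\boldsymbol s}v^{\boldsymbol s}\in L(\boldsymbol\zeta^{\boldsymbol s})$ is a highest $\ell^{\tilde{\boldsymbol s}}$-weight vector of $\ell^{\tilde{\boldsymbol s}}$-weight $$\Big(\zeta_2^{\boldsymbol s}(u)\frac{\psi^{\boldsymbol s}(u-s_1)}{\psi^{\boldsymbol s}(u)},\ \zeta_1^{\boldsymbol s}(u)\frac{\varphi^{\boldsymbol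 s}(u-s_1)}{\varphi^{\boldsymbol s}(u)}\Big).$$
   Context: Everything is over $\mathbb C$ and superalgebras/modules are $\mathbb Z_2$-graded (modules differing only by a parity shift are not distinguished). $S_{1|1}=\{(1,-1),(-1,1)\}$ is the set of parity sequences. For $\boldsymbol s\in S_{1|1}$ define $|i|\in\mathbb Z_2$ ($i=1,2$) by $s_i=(-1)^{|i|}$. The super Yangian $\mathrm Y(\mathfrak{gl}_{1|1}^{\boldsymbol s})$ is the unital associative superalgebra with generators $t_{ij}^{(r)}$ ($i,j\in\{1,2\}$, $r\ge1$) of parity $|i|+|j|$ and, with $t_{ij}(u)=\delta_{ij}+\sum_{r\ge1}t_{ij}^{(r)}u^{-r}$, defining relations $$(u_1-u_2)[t_{ij}(u_1),t_{kl}(u_2)]=(-1)^{|i||j|+|i||k|+|j||k|}\big(t_{kj}(u_1)t_{il}(u_2)-t_{kj}(u_2)t_{il}(u_1)\big)$$ ($[\cdot,\cdot]$ is the supercommutator). When the dependence on $\boldsymbol s$ matters, write $t_{ij}^{\boldsymbol s}(u)$. Drinfeld current series $d_1^{\boldsymbol s}(u),d_2^{\boldsymbol s}(u)\in 1+u^{-1}\mathrm Y[[u^{-1}]]$, $e^{\boldsymbol s}(u)=\sum_{r\ge1}e_r^{\boldsymbol s}u^{-r}$, $f^{\boldsymbol s}(u)=\sum_{r\ge1}f_r^{\boldsymbol s}u^{-r}$ are defined by $t_{11}(u)=d_1(u)$, $t_{12}(u)=d_1(u)e(u)$, $t_{21}(u)=f(u)d_1(u)$, $t_{22}(u)=d_2(u)+f(u)d_1(u)e(u)$.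 A nonzero $\mathbb Z_2$-homogeneous vector $v$ is a highest $\ell^{\boldsymbol s}$-weight vector of $\ell^{\boldsymbol s}$-weight $(\zeta_1(u),\zeta_2(u))$ if $e^{\boldsymbol s}(u)v=0$ and $d_i^{\boldsymbol s}(u)v=\zeta_i(u)v$ for $i=1,2$. For every such pair of series there is a unique irreducible module generated by such a vector. It is known that $L(\boldsymbol\zeta^{\boldsymbol s})$ is finite-dimensional if and only if $\zeta_1^{\boldsymbol s}(u)/\zeta_2^{\boldsymbol s}(u)$ is the expansion at $u=\infty$ of a ratio of relatively prime monic polynomials of equal degree. The super Yangians for $\boldsymbol s$ and $\tilde{\boldsymbol s}$ are identified via the isomorphism $t_{ij}^{\boldsymbol s}(u)\mapsto t_{3-i,3-j}^{\tilde{\boldsymbol s}}(u)$; in this way $L(\boldsymbol\zeta^{\boldsymbol s})$ is also a module over $\mathrm Y(\mathfrak{gl}_{1|1}^{\tilde{\boldsymbol s}})$, and highest $\ell^{\tilde{\boldsymbol s}}$-weight vectors are taken with respect to the series $d_i^{\tilde{\boldsymbol s}}(u),e^{\tilde{\boldsymbol s}}(u)$. Rational functions of $u$ are expanded at $u=\infty$. *)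

theory Defs
  imports
    "HOL-Library.Poly_Mapping"
    "HOL-Library.Z2"
    "HOL-Computational_Algebra.Computational_Algebra"
    "HOL-Algebra.QuotRing"
begin

section \<open>Parity sequences\<close>

datatype idx = I1 | I2

fun opp :: "idx \<Rightarrow> idx" where
  "opp I1 = I2"
| "opp I2 = I1"

definition S11 :: "(int \<times> int) set" where
  "S11 = {(1, -1), (-1, 1)}"

fun sgn_at :: "int \<times> int \<Rightarrow> idx \<Rightarrow> int" where
  "sgn_at s I1 = fst s"
| "sgn_at s I2 = snd s"

definition tilde :: "int \<times> int \<Rightarrow> int \<times> int" where
  "tilde s = (snd s, fst s)"

definition par :: "int \<times> int \<Rightarrow> idx \<Rightarrow> bit" where
  "par s i = (if sgn_at s i = 1 then 0 else 1)"

text \<open>The sign \<open>(-1)\<^sup>a\<close> for \<open>a\<close> in the integers modulo 2.\<close>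

definition sign :: "bit \<Rightarrow> 'a::ring_1" where
  "sign a = (if a = 0 then 1 else - 1)"


section \<open>The free algebra on the generators\<close>

text \<open>\<open>Gen i j n\<close> stands for the generator \<open>t\<^sub>i\<^sub>j\<close> of level \<open>n + 1\<close>, so that the levels are
  exactly the positive integers.\<close>

datatype gen = Gen idx idx nat

text \<open>Words form a monoid under concatenation, written additively so that the convolution product
  of finitely supported functions on words is the product of the free algebra.\<close>

datatype word = Word (letters: "gen list")

instantiation word :: monoid_add
begin

definition zero_word :: word where
  "0 = Word []"

definition plus_word :: "word \<Rightarrow> word \<Rightarrow> word" where
  "x + y = Word (letters x @ letters y)"

instance
  by standard (simp_all add: zero_word_def plus_word_def)

end

type_synonym free = "word \<Rightarrow>\<^sub>0 complex"

definition scalar :: "complex \<Rightarrow> free" where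
  "scalar c = Poly_Mapping.single 0 c"

definition gen :: "idx \<Rightarrow> idx \<Rightarrow> nat \<Rightarrow> free" where
  "gen i j n = Poly_Mapping.single (Word [Gen i j n]) 1"

text \<open>Power series in this file are series in \<open>u\<^sup>-\<^sup>1\<close>: the \<open>r\<close>-th coefficient belongs to \<open>u\<^sup>-\<^sup>r\<close>.\<close>

definition t_series :: "idx \<Rightarrow> idx \<Rightarrow> free fps" where
  "t_series i j =
     Abs_fps (\<lambda>r. case r of 0 \<Rightarrow> (if i = j then 1 else 0) | Suc n \<Rightarrow> gen i j n)"

abbreviation t_coeff :: "idx \<Rightarrow> idx \<Rightarrow> nat \<Rightarrow> free" where
  "t_coeff i j r \<equiv> fps_nth (t_series i j) r"

fun gen_par :: "int \<times> int \<Rightarrow> gen \<Rightarrow> bit" where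
  "gen_par s (Gen i j n) = par s i + par s j"

definition word_par :: "int \<times> int \<Rightarrow> word \<Rightarrow> bit" where
  "word_par s w = sum_list (map (gen_par s) (letters w))"

definition free_part :: "int \<times> int \<Rightarrow> bit \<Rightarrow> free set" where
  "free_part s a = {x. \<forall>w \<in> Poly_Mapping.keys x. word_par s w = a}"


section \<open>The super Yangian\<close>

text \<open>The supercommutator of \<open>x\<close> and \<open>y\<close>, of parities \<open>a\<close> and \<open>b\<close>.\<close>

definition scomm :: "bit \<Rightarrow> bit \<Rightarrow> free \<Rightarrow> free \<Rightarrow> free" where
  "scomm a b x y = x * y - sign (a * b) * (y * x)"

text \<open>\<open>relator s i j k l p q\<close> is the coefficient of \<open>u\<^sub>1\<^sup>-\<^sup>p u\<^sub>2\<^sup>-\<^sup>q\<close> in the difference of the two sides of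
  the defining relation for \<open>t\<^sub>i\<^sub>j(u\<^sub>1)\<close> and \<open>t\<^sub>k\<^sub>l(u\<^sub>2)\<close>. The remaining coefficients, at \<open>u\<^sub>1 u\<^sub>2\<^sup>-\<^sup>q\<close> and
  \<open>u\<^sub>1\<^sup>-\<^sup>p u\<^sub>2\<close>, are supercommutators with a constant \<open>\<delta>\<^sub>i\<^sub>j\<close> or \<open>\<delta>\<^sub>k\<^sub>l\<close> and vanish already in the
  free algebra.\<close>

definition relator :: "int \<times> int \<Rightarrow> idx \<Rightarrow> idx \<Rightarrow> idx \<Rightarrow> idx \<Rightarrow> nat \<Rightarrow> nat \<Rightarrow> free" where
  "relator s i j k l p q =
     scomm (par s i + par s j) (par s k + par s l) (t_coeff i j (Suc p)) (t_coeff k l q)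
   - scomm (par s i + par s j) (par s k + par s l) (t_coeff i j p) (t_coeff k l (Suc q))
   - sign (par s i * par s j + par s i * par s k + par s j * par s k) *
       (t_coeff k j p * t_coeff i l q - t_coeff k j q * t_coeff i l p)"

definition relators :: "int \<times> int \<Rightarrow> free set" where
  "relators s = {relator s i j k l p q | i j k l p q. True}"

definition free_ring :: "free ring" where
  "free_ring = \<lparr> carrier = UNIV, mult = (*), one = 1, zero = 0, add = (+) \<rparr>"

definition rel_ideal :: "int \<times> int \<Rightarrow> free set" where
  "rel_ideal s = genideal free_ring (relators s)"

definition yangian :: "int \<times> int \<Rightarrow> free set ring" where
  "yangian s = free_ring Quot (rel_ideal s)"

definition cls :: "int \<times> int \<Rightarrow> free \<Rightarrow> free set" where
  "cls s x = rel_ideal s +>\<^bsub>free_ring\<^esub> x"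

definition yangian_part :: "int \<times> int \<Rightarrow> bit \<Rightarrow> free set set" where
  "yangian_part s a = cls s ` free_part s a"


subsection \<open>Drinfeld current series\<close>

text \<open>The Gauss decomposition is solved in the free algebra, where it does not involve \<open>s\<close>. Its
  solution in the super Yangian is the image under \<open>cls s\<close>, coefficient by coefficient.\<close>

definition d1_series :: "free fps" where
  "d1_series = t_series I1 I1"

definition e_series :: "free fps" where
  "e_series = fps_right_inverse d1_series 1 * t_series I1 I2"

definition f_series :: "free fps" where
  "f_series = t_series I2 I1 * fps_left_inverse d1_series 1"

definition d2_series :: "free fps" where
  "d2_series = t_series I2 I2 - f_series * d1_series * e_series"

lemma gauss_decomposition:
  "t_series I1 I1 = d1_series"
  "t_series I1 I2 = d1_series * e_series"
  "t_series I2 I1 = f_series * d1_series"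
  "t_series I2 I2 = d2_series + f_series * d1_series * e_series"
proof -
  have 0: "fps_nth d1_series 0 = 1"
    by (simp add: d1_series_def t_series_def)
  have R: "d1_series * fps_right_inverse d1_series 1 = 1"
    using fps_right_inverse[of d1_series 1] 0 by simp
  have L: "fps_left_inverse d1_series 1 * d1_series = 1"
    using fps_left_inverse[of 1 d1_series] 0 by simp
  show "t_series I1 I1 = d1_series" by (simp add: d1_series_def)
  show "t_series I1 I2 = d1_series * e_series"
    unfolding e_series_def mult.assoc[symmetric] R by simp
  show "t_series I2 I1 = f_series * d1_series"
    unfolding f_series_def mult.assoc L by simp
  show "t_series I2 I2 = d2_series + f_series * d1_series * e_series"
    by (simp add: d2_series_def)
qed


subsection \<open>The isomorphism between the two super Yangians\<close>

fun opp_gen :: "gen \<Rightarrow> gen" where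
  "opp_gen (Gen i j n) = Gen (opp i) (opp j) n"

definition opp_word :: "word \<Rightarrow> word" where
  "opp_word w = Word (map opp_gen (letters w))"

text \<open>The algebra automorphism of the free algebra that sends \<open>t\<^sub>i\<^sub>j\<close> to
  \<open>t\<close> with indices \<open>3 - i\<close> and \<open>3 - j\<close>.\<close>

definition opp_free :: "free \<Rightarrow> free" where
  "opp_free x =
     (\<Sum>w \<in> Poly_Mapping.keys x. Poly_Mapping.single (opp_word w) (Poly_Mapping.lookup x w))"

text \<open>This maps the super Yangian of \<open>s\<close> to that of \<open>tilde s\<close>, and conversely; the two maps are
  mutually inverse.\<close>

definition yangian_iso :: "free set \<Rightarrow> free set" where
  "yangian_iso Y = opp_free ` Y"

lemma opp_opp [simp]: "opp (opp i) = i"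
  by (cases i) simp_all

lemma opp_gen_opp_gen [simp]: "opp_gen (opp_gen g) = g"
  by (cases g) simp

lemma opp_word_opp_word [simp]: "opp_word (opp_word w) = w"
proof -
  have "opp_gen \<circ> opp_gen = id" by (simp add: fun_eq_iff)
  then show ?thesis by (simp add: opp_word_def)
qed

lemma opp_word_add: "opp_word (x + y) = opp_word x + opp_word y"
  by (simp add: opp_word_def plus_word_def)

lemma opp_free_sum:
  assumes "finite A" "Poly_Mapping.keys x \<subseteq> A"
  shows "opp_free x =
    (\<Sum>w \<in> A. Poly_Mapping.single (opp_word w) (Poly_Mapping.lookup x w))"
  unfolding opp_free_def
  by (rule sum.mono_neutral_left) (use assms in \<open>auto simp: in_keys_iff\<close>)

lemma opp_free_add: "opp_free (x + y) = opp_free x + opp_free y"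
proof -
  let ?A = "Poly_Mapping.keys x \<union> Poly_Mapping.keys y"
  have "Poly_Mapping.keys (x + y) \<subseteq> ?A" by (rule Poly_Mapping.keys_add)
  then show ?thesis
    by (simp add: opp_free_sum[of ?A] lookup_add single_add sum.distrib)
qed

lemma opp_free_single [simp]:
  "opp_free (Poly_Mapping.single w c) = Poly_Mapping.single (opp_word w) c"
  by (subst opp_free_sum[of "{w}"]) auto

lemma opp_free_zero [simp]: "opp_free 0 = 0"
  by (simp add: opp_free_def)

lemma opp_free_induct [case_names add single]:
  fixes x :: free
  assumes "\<And>x y. P x \<Longrightarrow> P y \<Longrightarrow> P (x + y)" "\<And>w c. P (Poly_Mapping.single w c)"
  shows "P x"
proof -
  have *: "P (\<Sum>w \<in> A. Poly_Mapping.single w (g w))" if "finite A" for A and g :: "word \<Rightarrow> complex"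
    using that
  proof (induction A rule: finite_induct)
    case empty
    show ?case using assms(2)[of 0 0] by simp
  qed (simp add: assms)
  have "x = (\<Sum>w \<in> Poly_Mapping.keys x. Poly_Mapping.single w (Poly_Mapping.lookup x w))"
    by (rule poly_mapping_eqI)
      (simp add: lookup_sum lookup_single when_def in_keys_iff)
  then show ?thesis using *[of "Poly_Mapping.keys x" "Poly_Mapping.lookup x"] by simp
qed

lemma opp_free_opp_free [simp]: "opp_free (opp_free x) = x"
  by (induction x rule: opp_free_induct) (simp_all add: opp_free_add)

lemma opp_free_mult: "opp_free (x * y) = opp_free x * opp_free y"
proof (induction x rule: opp_free_induct)
  case (single w c)
  show ?case
  proof (induction y rule: opp_free_induct)
    case (single w' c')
    show ?case by (simp add: mult_single opp_word_add)
  qed (simp add: opp_free_add distrib_left)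
qed (simp add: opp_free_add distrib_right)

lemma opp_free_one [simp]: "opp_free 1 = 1"
proof -
  have "opp_word 0 = 0" by (simp add: opp_word_def zero_word_def)
  then show ?thesis using opp_free_single[of 0 1] by simp
qed

lemma opp_free_uminus: "opp_free (- x) = - opp_free x"
  by (metis add_eq_0_iff opp_free_add opp_free_zero)

lemma opp_free_diff: "opp_free (x - y) = opp_free x - opp_free y"
  by (metis opp_free_add opp_free_uminus diff_conv_add_uminus)

lemma opp_free_t_coeff: "opp_free (t_coeff i j r) = t_coeff (opp i) (opp j) r"
proof -
  have "opp i = opp j \<longleftrightarrow> i = j" by (metis opp_opp)
  then show ?thesis
    by (auto simp: t_series_def gen_def opp_word_def split: nat.splits)
qed

lemma ring_free_ring: "ring free_ring"
proof -
  have "\<exists>y. x + y = 0 \<and> y + x = 0" for x :: free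
    by (rule exI[of _ "- x"]) simp
  then show ?thesis
    by unfold_locales (auto simp: free_ring_def algebra_simps Units_def)
qed

lemma par_tilde [simp]: "par (tilde s) i = par s (opp i)"
  by (cases i) (simp_all add: par_def tilde_def)

lemma opp_free_sign: "opp_free (sign a) = sign a"
  unfolding sign_def by (simp add: opp_free_uminus)

lemma opp_free_relator:
  "opp_free (relator s i j k l p q) = relator (tilde s) (opp i) (opp j) (opp k) (opp l) p q"
  unfolding relator_def scomm_def par_tilde opp_opp
  by (simp only: opp_free_diff opp_free_sign opp_free_mult opp_free_t_coeff)

lemma tilde_tilde [simp]: "tilde (tilde s) = s"
  by (simp add: tilde_def)

lemma ideal_rel_ideal: "ideal (rel_ideal s) free_ring"
  unfolding rel_ideal_def
  by (rule ring.genideal_ideal[OF ring_free_ring]) (simp add: free_ring_def)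

lemma opp_free_rel_ideal_subset: "opp_free ` rel_ideal s \<subseteq> rel_ideal (tilde s)"
proof -
  let ?J = "{x. opp_free x \<in> rel_ideal (tilde s)}"
  interpret I: ideal "rel_ideal (tilde s)" free_ring by (rule ideal_rel_ideal)
  have z: "0 \<in> rel_ideal (tilde s)"
    using additive_subgroup.zero_closed[OF I.additive_subgroup_axioms]
    by (simp add: free_ring_def)
  have a: "x + y \<in> rel_ideal (tilde s)"
    if "x \<in> rel_ideal (tilde s)" "y \<in> rel_ideal (tilde s)" for x y
    using additive_subgroup.a_closed[OF I.additive_subgroup_axioms that] by (simp add: free_ring_def)
  have l: "y * x \<in> rel_ideal (tilde s)" if "x \<in> rel_ideal (tilde s)" for x y
    using I.I_l_closed[OF that, of y] by (simp add: free_ring_def)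
  have r: "x * y \<in> rel_ideal (tilde s)" if "x \<in> rel_ideal (tilde s)" for x y
    using I.I_r_closed[OF that, of y] by (simp add: free_ring_def)
  have m: "- x \<in> rel_ideal (tilde s)" if "x \<in> rel_ideal (tilde s)" for x
    using l[OF that, of "- 1"] by simp
  have inv: "\<ominus>\<^bsub>free_ring\<^esub> x = - x" for x
    by (rule I.minus_equality) (simp_all add: free_ring_def)
  have "ideal ?J free_ring"
  proof (rule idealI)
    show "ring free_ring" by (rule ring_free_ring)
    show "subgroup ?J (add_monoid free_ring)"
      by (rule I.add.subgroupI)
        (use z a m in \<open>auto simp: inv[unfolded free_ring_def] free_ring_def opp_free_add opp_free_uminus
           intro: exI[of _ 0]\<close>)
  qed (use l r in \<open>auto simp: free_ring_def opp_free_mult\<close>)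
  moreover have "relators s \<subseteq> ?J"
  proof
    fix x assume "x \<in> relators s"
    then obtain i j k l p q where x: "x = relator s i j k l p q"
      by (auto simp: relators_def)
    have "opp_free x \<in> relators (tilde s)"
      unfolding x opp_free_relator relators_def by blast
    moreover have "relators (tilde s) \<subseteq> rel_ideal (tilde s)"
      unfolding rel_ideal_def
      by (rule I.genideal_self) (simp add: free_ring_def)
    ultimately show "x \<in> ?J" by auto
  qed
  ultimately have "rel_ideal s \<subseteq> ?J"
    unfolding rel_ideal_def[of s] by (intro I.genideal_minimal)
  then show ?thesis by auto
qed

lemma opp_free_rel_ideal: "opp_free ` rel_ideal s = rel_ideal (tilde s)"
proof
  show "rel_ideal (tilde s) \<subseteq> opp_free ` rel_ideal s"
  proof
    fix x assume "x \<in> rel_ideal (tilde s)"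
    then have "opp_free x \<in> rel_ideal s"
      using opp_free_rel_ideal_subset[of "tilde s"] by auto
    then show "x \<in> opp_free ` rel_ideal s"
      by (metis image_eqI opp_free_opp_free)
  qed
qed (rule opp_free_rel_ideal_subset)

lemma cls_eq: "cls s x = {z + x | z. z \<in> rel_ideal s}"
  by (auto simp: cls_def a_r_coset_def r_coset_def free_ring_def)

lemma yangian_iso_cls: "yangian_iso (cls s x) = cls (tilde s) (opp_free x)"
proof -
  have "yangian_iso (cls s x) = {opp_free z + opp_free x | z. z \<in> rel_ideal s}"
    by (auto simp: yangian_iso_def cls_eq opp_free_add image_def)
  also have "\<dots> = {z + opp_free x | z. z \<in> opp_free ` rel_ideal s}"
    by auto
  finally show ?thesis by (simp add: opp_free_rel_ideal cls_eq)
qed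

lemma carrier_yangian: "carrier (yangian s) = range (cls s)"
  by (auto simp: yangian_def FactRing_def A_RCOSETS_def RCOSETS_def cls_def a_r_coset_def
      free_ring_def)

lemma cls_mult: "cls s x \<otimes>\<^bsub>yangian s\<^esub> cls s y = cls s (x * y)"
  using ideal.rcoset_mult_add[OF ideal_rel_ideal, of x y s]
  by (simp add: yangian_def FactRing_def cls_def) (simp add: free_ring_def)

lemma cls_add: "cls s x \<oplus>\<^bsub>yangian s\<^esub> cls s y = cls s (x + y)"
proof -
  interpret I: ideal "rel_ideal s" free_ring by (rule ideal_rel_ideal)
  show ?thesis
    using I.a_rcos_sum[of x y]
    by (simp add: yangian_def FactRing_def cls_def) (simp add: free_ring_def)
qed

lemma cls_one: "\<one>\<^bsub>yangian s\<^esub> = cls s 1"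
  by (simp add: yangian_def FactRing_def cls_def) (simp add: free_ring_def)

lemma yangian_iso: "yangian_iso \<in> ring_iso (yangian s) (yangian (tilde s))"
proof -
  have "yangian_iso (yangian_iso Y) = Y" for Y
    by (simp add: yangian_iso_def image_image)
  then have "bij_betw yangian_iso (carrier (yangian s)) (carrier (yangian (tilde s)))"
    by (intro bij_betw_byWitness[of _ yangian_iso])
      (auto simp: carrier_yangian yangian_iso_cls)
  then show ?thesis
    by (auto simp: ring_iso_def intro!: ring_hom_memI)
      (auto simp: carrier_yangian yangian_iso_cls cls_mult cls_add cls_one
         opp_free_mult opp_free_add)
qed


section \<open>Modules\<close>

record 'v ymod =
  ym_scale :: "complex \<Rightarrow> 'v \<Rightarrow> 'v"
  ym_part :: "bit \<Rightarrow> 'v set"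
  ym_act :: "free set \<Rightarrow> 'v \<Rightarrow> 'v"

definition end_ring :: "(complex \<Rightarrow> 'v::ab_group_add \<Rightarrow> 'v) \<Rightarrow> ('v \<Rightarrow> 'v) ring" where
  "end_ring sc =
     \<lparr> carrier = {g. Vector_Spaces.linear sc sc g}, mult = (\<circ>), one = id,
       zero = (\<lambda>v. 0), add = (\<lambda>g h v. g v + h v) \<rparr>"

definition z2_grading ::
  "(complex \<Rightarrow> 'v::ab_group_add \<Rightarrow> 'v) \<Rightarrow> (bit \<Rightarrow> 'v set) \<Rightarrow> bool" where
  "z2_grading sc V \<longleftrightarrow>
     (\<forall>a. module.subspace sc (V a)) \<and> V 0 \<inter> V 1 = {0} \<and>
     (\<forall>v. \<exists>v0 \<in> V 0. \<exists>v1 \<in> V 1. v = v0 + v1)"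

definition yangian_module :: "int \<times> int \<Rightarrow> ('v::ab_group_add) ymod \<Rightarrow> bool" where
  "yangian_module s M \<longleftrightarrow>
     vector_space (ym_scale M) \<and> z2_grading (ym_scale M) (ym_part M) \<and>
     ym_act M \<in> ring_hom (yangian s) (end_ring (ym_scale M)) \<and>
     (\<forall>c. ym_act M (cls s (scalar c)) = ym_scale M c) \<and>
     (\<forall>a b. \<forall>Y \<in> yangian_part s a. \<forall>v \<in> ym_part M b. ym_act M Y v \<in> ym_part M (a + b))"

definition submodule :: "int \<times> int \<Rightarrow> ('v::ab_group_add) ymod \<Rightarrow> 'v set \<Rightarrow> bool" where
  "submodule s M W \<longleftrightarrow>
     module.subspace (ym_scale M) W \<and>
     (\<forall>w \<in> W. \<exists>w0 \<in> W \<inter> ym_part M 0. \<exists>w1 \<in> W \<inter> ym_part M 1. w = w0 + w1) \<and>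
     (\<forall>Y \<in> carrier (yangian s). \<forall>w \<in> W. ym_act M Y w \<in> W)"

definition irreducible_module :: "int \<times> int \<Rightarrow> ('v::ab_group_add) ymod \<Rightarrow> bool" where
  "irreducible_module s M \<longleftrightarrow>
     yangian_module s M \<and> (\<exists>v::'v. v \<noteq> 0) \<and>
     (\<forall>W. submodule s M W \<longrightarrow> W = {0} \<or> W = UNIV)"

definition generated_by :: "int \<times> int \<Rightarrow> ('v::ab_group_add) ymod \<Rightarrow> 'v \<Rightarrow> bool" where
  "generated_by s M v \<longleftrightarrow> (\<forall>W. submodule s M W \<and> v \<in> W \<longrightarrow> W = UNIV)"

definition finite_dim :: "('v::ab_group_add) ymod \<Rightarrow> bool" where
  "finite_dim M \<longleftrightarrow> (\<exists>B. finite B \<and> module.span (ym_scale M) B = UNIV)"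

text \<open>A module over the super Yangian of \<open>s\<close>, regarded as one over that of \<open>tilde s\<close>.\<close>

definition tilde_module :: "'v ymod \<Rightarrow> 'v ymod" where
  "tilde_module M = M \<lparr> ym_act := (\<lambda>Y. ym_act M (yangian_iso Y)) \<rparr>"

definition highest_lweight_vector ::
  "int \<times> int \<Rightarrow> ('v::ab_group_add) ymod \<Rightarrow> complex fps \<Rightarrow> complex fps \<Rightarrow> 'v \<Rightarrow> bool" where
  "highest_lweight_vector s M \<zeta>1 \<zeta>2 v \<longleftrightarrow>
     v \<noteq> 0 \<and> v \<in> ym_part M 0 \<union> ym_part M 1 \<and>
     (\<forall>r. ym_act M (cls s (fps_nth e_series r)) v = 0) \<and>
     (\<forall>r. ym_act M (cls s (fps_nth d1_series r)) v = ym_scale M (fps_nth \<zeta>1 r) v) \<and>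
     (\<forall>r. ym_act M (cls s (fps_nth d2_series r)) v = ym_scale M (fps_nth \<zeta>2 r) v)"

text \<open>The vector \<open>f\<^sub>1 (f\<^sub>2 (\<dots> (f\<^sub>k v)))\<close>.\<close>

definition f_string :: "int \<times> int \<Rightarrow> 'v ymod \<Rightarrow> nat \<Rightarrow> 'v \<Rightarrow> 'v" where
  "f_string s M k v = foldr (\<lambda>r. ym_act M (cls s (fps_nth f_series r))) [1..<Suc k] v"


section \<open>Expansion of rational functions at infinity\<close>

text \<open>The expansion of \<open>p(u) / q(u)\<close> in powers of \<open>u\<^sup>-\<^sup>1\<close>, for \<open>degree p \<le> degree q\<close> and \<open>q \<noteq> 0\<close>;
  note that \<open>reflect_poly p\<close> takes the value \<open>u\<^bsup>-degree p\<^esup> p(u)\<close> at \<open>u\<^sup>-\<^sup>1\<close>.\<close>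

definition expand_at_infinity :: "complex poly \<Rightarrow> complex poly \<Rightarrow> complex fps" where
  "expand_at_infinity p q =
     fps_X ^ (degree q - degree p) *
       (fps_of_poly (reflect_poly p) / fps_of_poly (reflect_poly q))"

definition shift_poly :: "int \<Rightarrow> complex poly \<Rightarrow> complex poly" where
  "shift_poly a p = pcompose p [:- of_int a, 1:]"

end

theory Submission
  imports Defs "HOL-Computational_Algebra.Field_as_Ring"
begin

text \<open>
Write \<open>T\<close> for the currents acting on the module, \<open>d = t\<^sub>1\<^sub>1\<close>, and \<open>\<sigma> = s\<^sub>1\<close>. The \<open>f\<^sub>r\<close> anticommute,
and conjugation by \<open>d(u)\<close> sends \<open>f\<^sub>b - u\<^sup>-\<^sup>1 f\<^sub>b\<^sub>+\<^sub>1\<close> to \<open>(1 - \<sigma> u\<^sup>-\<^sup>1) f\<^sub>b - u\<^sup>-\<^sup>1 f\<^sub>b\<^sub>+\<^sub>1\<close>. The anticommutators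
\<open>h\<^sub>b\<close> of \<open>e\<^sub>1\<close> with \<open>f\<^sub>b\<close> are central, hence scalars on \<open>L\<close>, with generating series
\<open>\<sigma> (\<zeta>\<^sub>2 / \<zeta>\<^sub>1 - 1) = \<sigma> (\<psi> - \<phi>) / \<phi>\<close>. The elements \<open>\<Sum>\<^sub>j \<phi>\<^sub>j f\<^sub>j\<^sub>+\<^sub>r\<close> therefore anticommute with \<open>e\<^sub>1\<close>, so that
their common kernel is a submodule; it is nonzero since \<open>L\<close> is finite-dimensional, and thus they
vanish. Hence \<open>\<Omega> = f\<^sub>1 \<dots> f\<^sub>k v\<close> is killed by all \<open>f\<^sub>b\<close>, and \<open>\<Omega> \<noteq> 0\<close> because the Hankel form \<open>h\<close> is
nondegenerate by coprimality. The eigenvalue of \<open>d\<close> on \<open>\<Omega>\<close> is \<open>\<zeta>\<^sub>1\<close> times a quotient of determinants of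
companion matrices of \<open>\<phi>\<close>, at \<open>u - \<sigma>\<close> and at \<open>u\<close>. Finally \<open>t\<^sub>2\<^sub>2 \<Omega>\<close> is computed from
\<open>t\<^sub>2\<^sub>2 = d + \<sigma> (e\<^sub>1 t\<^sub>2\<^sub>1 + t\<^sub>2\<^sub>1 e\<^sub>1)\<close>: the scalars \<open>q\<^sub>b(u)\<close> with \<open>f\<^sub>b d(u) e\<^sub>1 \<Omega> = q\<^sub>b(u) \<Omega>\<close> satisfy a
first-order recurrence in \<open>b\<close>, which is closed up by \<open>\<phi>\<close>.
\<close>

unbundle fps_syntax


section \<open>Series in two variables\<close>

definition iw :: "'a::ring_1 fps \<Rightarrow> 'a fps fps" where
  "iw F = Abs_fps (\<lambda>n. fps_const (F $ n))"

lemma iw_nth [simp]: "iw F $ n = fps_const (F $ n)"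
  by (simp add: iw_def)

lemma iw_mult: "iw (F * G) = iw F * iw G"
proof (rule fps_ext)
  fix n
  have *: "fps_const (sum g A) = (\<Sum>i\<in>A. fps_const (g i))" for g :: "nat \<Rightarrow> 'a" and A
    by (rule fps_ext) (simp add: fps_sum_nth)
  show "iw (F * G) $ n = (iw F * iw G) $ n"
    by (simp add: fps_mult_nth *)
qed

lemma iw_diff: "iw (F - G) = iw F - iw G"
  by (rule fps_ext) simp

lemma iw_one: "iw 1 = 1"
  by (rule fps_ext) simp

text \<open>In series of series the inner variable is \<open>u\<^sup>-\<^sup>1\<close> and the outer one \<open>w\<^sup>-\<^sup>1\<close>, so that a series in
  \<open>u\<close> is embedded by \<^const>\<open>fps_const\<close> and one in \<open>w\<close> by \<^const>\<open>iw\<close>.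
  Multiplying by \<open>udiff\<close> is multiplying by \<open>u - w\<close> and clearing the denominator \<open>u w\<close>.\<close>

definition udiff :: "'a::ring_1 fps fps" where
  "udiff = fps_X - fps_const fps_X"

lemma udiff_commute: "udiff * F = F * (udiff :: 'a::ring_1 fps fps)"
proof -
  have "fps_const fps_X * F = F * fps_const fps_X"
    by (rule fps_ext) (simp add: fps_mult_fps_X_commute)
  then show ?thesis
    by (simp add: udiff_def algebra_simps fps_mult_fps_X_commute)
qed

text \<open>Each outer coefficient of the equation says that \<open>fps_X * F $ n\<close> is the
  preceding coefficient of \<open>F\<close>, so the coefficients vanish successively because
  \<open>fps_X\<close> can be cancelled.\<close>

lemma udiff_eq_0:
  assumes "udiff * F = (0 :: 'a::ring_1 fps fps)"
  shows "F = 0"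
proof (rule fps_ext)
  have step: "fps_X * F $ n = (if n = 0 then 0 else F $ (n - 1))" for n
  proof -
    have "(udiff * F) $ n = 0" using assms by simp
    then show ?thesis by (simp add: udiff_def left_diff_distrib)
  qed
  have X: "G = 0" if "fps_X * G = 0" for G :: "'a fps"
  proof (rule fps_ext)
    fix n
    have "(fps_X * G) $ Suc n = 0" using that by simp
    then show "G $ n = 0 $ n" by simp
  qed
  fix n
  show "F $ n = 0 $ n"
    by (induction n) (use step[of 0] step[of "Suc _"] X in \<open>auto simp del: fps_X_mult_nth\<close>)
qed

text \<open>Passes from coefficients to generating series. Row and column zero of the coefficient
  table are not reached by the first hypothesis; there a constant term 0 or 1 commutes with
  everything.\<close>

lemma bivariate_relation:
  fixes P Q R S P' Q' R' S' :: "'a::ring_1 fps"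
  assumes "\<And>p q. (P $ Suc p * Q $ q - Q $ q * P $ Suc p) - (P $ p * Q $ Suc q - Q $ Suc q * P $ p)
      = c * (R $ p * S $ q - R' $ q * S' $ p)"
    and "P $ 0 \<in> {0, 1}" "Q $ 0 \<in> {0, 1}" and c: "c = 1 \<or> c = -1"
  shows "udiff * (fps_const P * iw Q - iw Q * fps_const P) =
    fps_const (fps_const c) * (fps_const fps_X * fps_X * (fps_const R * iw S - iw R' * fps_const S'))"
proof (rule fps_ext, rule fps_ext)
  fix q p
  show "(udiff * (fps_const P * iw Q - iw Q * fps_const P)) $ q $ p =
    (fps_const (fps_const c) * (fps_const fps_X * fps_X * (fps_const R * iw S - iw R' * fps_const S'))) $ q $ p"
    using assms(1)[of "p - 1" "q - 1"] assms(2,3)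
    by (cases p; cases q)
      (auto simp: udiff_def left_diff_distrib mult.assoc right_diff_distrib algebra_simps)
qed

section \<open>Currents of the super Yangian in an arbitrary ring\<close>

text \<open>\<open>rel11\<close> is the defining relation with \<open>T I1 I1\<close> in the first
  slot: this current is even, so the supercommutator is an ordinary one, and the sign reduces to
  \<open>s_1\<close>. In \<open>cross\<close> the sign is \<open>s_2 = - s_1\<close>, which swaps
  the two terms on the right.\<close>

locale gl11 =
  fixes T :: "idx \<Rightarrow> idx \<Rightarrow> 'a::ring_1 fps" and \<sigma> :: 'a
  assumes sgn: "\<sigma> = 1 \<or> \<sigma> = -1"
    and half: "\<And>x :: 'a. x + x = 0 \<Longrightarrow> x = 0"
    and T0: "\<And>i j. T i j $ 0 = (if i = j then 1 else 0)"
    and rel11: "\<And>k l p q.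
      (T I1 I1 $ Suc p * T k l $ q - T k l $ q * T I1 I1 $ Suc p)
      - (T I1 I1 $ p * T k l $ Suc q - T k l $ Suc q * T I1 I1 $ p)
      = \<sigma> * (T k I1 $ p * T I1 l $ q - T k I1 $ q * T I1 l $ p)"
    and sq12: "T I1 I2 $ Suc 0 * T I1 I2 $ Suc 0 = 0"
    and sq21: "T I2 I1 $ Suc 0 * T I2 I1 $ Suc 0 = 0"
    and cross: "\<And>n. T I1 I2 $ Suc 0 * T I2 I1 $ n + T I2 I1 $ n * T I1 I2 $ Suc 0 = \<sigma> * (T I2 I2 $ n - T I1 I1 $ n)"
begin

abbreviation "d \<equiv> T I1 I1"
abbreviation "t12 \<equiv> T I1 I2"
abbreviation "t21 \<equiv> T I2 I1"
abbreviation "t22 \<equiv> T I2 I2"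
abbreviation "e1 \<equiv> t12 $ Suc 0"

definition g where "g = fps_left_inverse d 1"
definition f where "f = t21 * g"
text \<open>Since \<open>t_12 = d e\<close>, this is the Drinfeld current
  \<open>t_22 - f d e\<close>.\<close>

definition d2 where "d2 = t22 - f * t12"
definition h where "h = Abs_fps (\<lambda>n. e1 * f $ n + f $ n * e1)"

lemma sigma_commute: "\<sigma> * x = x * \<sigma>"
  using sgn by auto

lemma sigma_sigma [simp]: "\<sigma> * \<sigma> = 1" "\<sigma> * (\<sigma> * x) = x"
  using sgn by auto

lemma gd: "g * d = 1" and dg: "d * g = 1"
proof -
  show 1: "g * d = 1" unfolding g_def by (rule fps_left_inverse) (simp add: T0)
  have 2: "d * fps_right_inverse d 1 = 1" by (rule fps_right_inverse) (simp add: T0)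
  have "g = g * (d * fps_right_inverse d 1)" unfolding 2 by simp
  also have "\<dots> = fps_right_inverse d 1" unfolding mult.assoc[symmetric] 1 by simp
  finally show "d * g = 1" using 2 by simp
qed

lemma fd: "f * d = t21"
  by (simp add: f_def mult.assoc gd)

lemma f0 [simp]: "f $ 0 = 0"
  by (simp add: f_def T0)

lemma f1: "f $ Suc 0 = t21 $ Suc 0"
  using arg_cong[OF fd, of "\<lambda>F. F $ Suc 0"] by (simp add: T0)

text \<open>The relation moves one level from the first factor to the second, up to a commutator at
  level \<open>p\<close>, and \<open>d $ 0 = 1\<close> is central.\<close>

lemma d_commute: "d $ p * d $ q = d $ q * d $ p"
proof (induction p arbitrary: q)
  case 0
  then show ?case by (simp add: T0)
next
  case (Suc p)
  show ?case using rel11[of p I1 I1 q] Suc by (simp add: algebra_simps)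
qed

text \<open>Level zero of the second current in \<open>rel11\<close>. Together with
  \<open>t12_eq\<close> and \<open>cross\<close> it expresses all currents through
  \<open>e1\<close>, \<open>t21 $ Suc 0\<close> and \<open>d\<close>.\<close>

lemma t21_eq: "d $ n * t21 $ Suc 0 - t21 $ Suc 0 * d $ n = - (\<sigma> * t21 $ n)"
proof -
  have "0 - (d $ n * t21 $ Suc 0 - t21 $ Suc 0 * d $ n) = \<sigma> * t21 $ n"
    using rel11[of n I2 I1 0] by (simp add: T0)
  then show ?thesis by (metis add.inverse_inverse diff_0)
qed

lemma t12_eq: "d $ n * e1 - e1 * d $ n = \<sigma> * t12 $ n"
proof -
  have "0 - (d $ n * e1 - e1 * d $ n) = \<sigma> * (0 - t12 $ n)"
    using rel11[of n I1 I2 0] by (simp add: T0)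
  then show ?thesis
    by (metis diff_0 minus_diff_eq minus_mult_right neg_equal_iff_equal)
qed

lemma biv11:
  "udiff * (fps_const d * iw (T k l) - iw (T k l) * fps_const d) =
    fps_const (fps_const \<sigma>) * (fps_const fps_X * fps_X *
      (fps_const (T k I1) * iw (T I1 l) - iw (T k I1) * fps_const (T I1 l)))"
  by (rule bivariate_relation[OF rel11]) (simp_all add: T0 sgn)

text \<open>The factor \<open>\<sigma> u^-1 w^-1\<close> on the right of the relation cleared of
  denominators.\<close>

definition z :: "'a fps fps" where "z = fps_const (fps_const \<sigma>) * (fps_const fps_X * fps_X)"

lemma z_commute: "z * F = F * z"
proof -
  have "fps_const fps_X * G = G * fps_const fps_X" for G :: "'a fps fps"
    by (rule fps_ext) (simp add: fps_mult_fps_X_commute)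
  then have *: "(fps_const fps_X * fps_X) * G = G * (fps_const fps_X * fps_X)" for G :: "'a fps fps"
    by (metis fps_mult_fps_X_commute mult.assoc)
  show ?thesis
    using sgn *[of F] unfolding z_def by (auto simp flip: fps_const_neg)
qed

end

lemma commute_inverse:
  fixes x :: "'b::monoid_mult"
  assumes "x * y = y * x" "y * y' = 1" "y' * y = 1"
  shows "x * y' = y' * x"
proof -
  have "x * y' = (y' * y) * x * y'" using assms(3) by simp
  also have "\<dots> = y' * x * (y * y')" using assms(1) by (simp add: mult.assoc) (metis mult.assoc)
  finally show ?thesis using assms(2) by simp
qed

text \<open>This and the next two rules apply a commutation relation in the middle of a longer
  product.\<close>

lemma mult_left_commuteI:
  fixes x :: "'b::semigroup_mult"
  shows "x * y = y * x \<Longrightarrow> x * (y * w) = y * (x * w)"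
  by (simp flip: mult.assoc)

lemma mult_left_anticommuteI:
  fixes x :: "'b::ring"
  shows "x * y = - (y * x) \<Longrightarrow> x * (y * w) = - (y * (x * w))"
  by (simp flip: mult.assoc)

lemma mult_left_zeroI:
  fixes x :: "'b::semiring_0"
  shows "x * y = 0 \<Longrightarrow> x * (y * w) = 0"
  by (simp flip: mult.assoc)

context gl11
begin

section \<open>Relations between \<open>d\<close> and \<open>f\<close>, and anticommutativity of the
  coefficients of \<open>f\<close>\<close>

lemma const_d_iw_d: "fps_const d * iw d = iw d * fps_const d"
  by (rule fps_ext, rule fps_ext) (simp add: d_commute)

lemma iw_gd: "iw g * iw d = 1" "iw d * iw g = 1"
  by (simp_all add: gd dg iw_one flip: iw_mult)

lemma const_d_iw_g: "fps_const d * iw g = iw g * fps_const d"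
  by (rule commute_inverse[OF const_d_iw_d iw_gd(2,1)])

lemma biv11_z:
  "udiff * (fps_const d * iw (T k l) - iw (T k l) * fps_const d) =
    z * (fps_const (T k I1) * iw (T I1 l) - iw (T k I1) * fps_const (T I1 l))"
  by (simp add: biv11 z_def mult.assoc)

lemma iw_f: "iw f = iw t21 * iw g"
  by (simp add: f_def iw_mult)

text \<open>The relation of \<open>d(u)\<close> with \<open>t_21(w)\<close>, multiplied on the right
  by \<open>g(w)\<close>, which commutes with \<open>d(u)\<close>.\<close>

lemma udiff_d_f:
  "udiff * (fps_const d * iw f - iw f * fps_const d) = z * (fps_const (f * d) - iw f * fps_const d)"
proof -
  have "udiff * (fps_const d * iw f - iw f * fps_const d)
      = udiff * (fps_const d * iw t21 - iw t21 * fps_const d) * iw g"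
    by (simp add: iw_f right_diff_distrib left_diff_distrib mult.assoc const_d_iw_g)
  also have "\<dots> = z * ((fps_const t21 * (iw d * iw g)) - iw t21 * (fps_const d * iw g))"
    unfolding biv11_z by (simp only: right_diff_distrib left_diff_distrib mult.assoc)
  also have "\<dots> = z * (fps_const (f * d) - iw f * fps_const d)"
    by (simp add: iw_gd const_d_iw_g iw_f mult.assoc fd)
  finally show ?thesis .
qed

text \<open>The coefficient of \<open>w^-(n+1)\<close>. For \<open>n >= 1\<close> the term
  \<open>f(u) d(u)\<close>, which is constant in \<open>w\<close>, does not contribute.\<close>

lemma d_const_f:
  assumes "n \<ge> 1"
  shows "d * fps_const (f $ n) - fps_const (f $ n) * d
    - fps_X * (d * fps_const (f $ Suc n) - fps_const (f $ Suc n) * d)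
    = - (fps_const \<sigma> * (fps_X * (fps_const (f $ n) * d)))"
  using arg_cong[OF udiff_d_f, of "\<lambda>F. F $ Suc n"] assms
  by (simp add: udiff_def z_def left_diff_distrib[of fps_X] mult.assoc)

lemma d_f_coeff:
  assumes "n \<ge> 1"
  shows "d $ Suc m * f $ n - f $ n * d $ Suc m - (d $ m * f $ Suc n - f $ Suc n * d $ m)
    = - (\<sigma> * (f $ n * d $ m))"
  using arg_cong[OF d_const_f[OF assms], of "\<lambda>F. F $ Suc m"] by simp

lemma d1_f: "n \<ge> 1 \<Longrightarrow> d $ Suc 0 * f $ n = f $ n * d $ Suc 0 - \<sigma> * f $ n"
  using d_f_coeff[of n 0] by (simp add: T0 algebra_simps)

text \<open>Levels two and one of \<open>d\<close> isolate the next coefficient of \<open>f\<close>,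
  so properties of \<open>f $ Suc 0\<close> propagate to all coefficients by induction.\<close>

lemma f_Suc:
  assumes "n \<ge> 1"
  shows "f $ Suc n = - (\<sigma> * (d $ 2 * f $ n - f $ n * d $ 2)) - f $ n * d $ Suc 0"
proof -
  have "d $ 2 * f $ n - f $ n * d $ 2 = (d $ Suc 0 * f $ Suc n - f $ Suc n * d $ Suc 0) - \<sigma> * (f $ n * d $ Suc 0)"
    using d_f_coeff[OF assms, of "Suc 0"] by (simp add: numeral_2_eq_2 algebra_simps)
  also have "\<dots> = - (\<sigma> * f $ Suc n) - \<sigma> * (f $ n * d $ Suc 0)"
    by (simp only: d1_f[of "Suc n", simplified])
      simp
  finally have "d $ 2 * f $ n - f $ n * d $ 2 = - (\<sigma> * f $ Suc n) - \<sigma> * (f $ n * d $ Suc 0)" .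
  then have "\<sigma> * (d $ 2 * f $ n - f $ n * d $ 2) = - f $ Suc n - f $ n * d $ Suc 0"
    by (simp add: right_diff_distrib)
  then show ?thesis by simp
qed

lemma d_const_f1: "d * fps_const (f $ Suc 0) = (fps_const (f $ Suc 0) - fps_const \<sigma> * f) * d"
proof (rule fps_ext)
  fix n
  show "(d * fps_const (f $ Suc 0)) $ n = ((fps_const (f $ Suc 0) - fps_const \<sigma> * f) * d) $ n"
    using t21_eq[of n] by (simp add: left_diff_distrib mult.assoc fd f1) (simp add: algebra_simps)
qed

text \<open>By \<open>d_const_f1\<close>, \<open>S = f_1 - \<sigma> f(u)\<close> is the conjugate of
  \<open>f_1\<close> by \<open>d(u)\<close>, hence squares to zero like \<open>f_1\<close>;
  expanding \<open>S * S\<close> gives the formula.\<close>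

lemma f_square:
  "f * f = fps_const \<sigma> * (fps_const (f $ Suc 0) * f + f * fps_const (f $ Suc 0))"
proof -
  let ?F = "fps_const (f $ Suc 0)" and ?s = "fps_const \<sigma>"
  define S where "S = ?F - ?s * f"
  have FF: "?F * ?F = 0" using sq21 by (simp add: f1)
  have dF: "d * ?F = S * d" by (simp only: d_const_f1 S_def)
  have "S * S * d = S * (S * d)" by (rule mult.assoc)
  also have "\<dots> = S * d * ?F" by (simp only: flip: dF mult.assoc)
  also have "\<dots> = d * (?F * ?F)" by (simp only: mult.assoc flip: dF)
  finally have "S * S * d = 0" unfolding FF by simp
  then have "S * S * (d * g) = 0" by (simp flip: mult.assoc)
  then have SS: "S * S = 0" by (simp add: dg)
  have "?s = 1 \<or> ?s = - 1" using sgn by (auto simp flip: fps_const_neg)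
  then have "S * S = ?F * ?F - ?s * (?F * f + f * ?F) + f * f"
    unfolding S_def by (elim disjE; simp only:) (simp_all add: algebra_simps)
  then show ?thesis using SS FF by (simp add: algebra_simps)
qed

text \<open>Take the commutator of \<open>d $ 2\<close> with the vanishing anticommutator and
  rewrite it by \<open>f_Suc\<close>; the terms with \<open>d $ Suc 0\<close> again combine to
  multiples of that anticommutator.\<close>

lemma f_anticommute_step:
  assumes "f $ a * f $ b + f $ b * f $ a = 0" "a \<ge> 1" "b \<ge> 1"
  shows "f $ Suc a * f $ b + f $ b * f $ Suc a = - (f $ a * f $ Suc b + f $ Suc b * f $ a)"
proof -
  have d1: "d $ Suc 0 * f $ n = f $ n * d $ Suc 0 - \<sigma> * f $ n" if "n \<ge> 1" for n using d1_f[OF that] .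
  have ba: "f $ b * f $ a = - (f $ a * f $ b)" using assms(1) by (metis add.commute add_eq_0_iff)
  note ba' = mult_left_anticommuteI[OF ba]
  have s: "f $ n * (\<sigma> * x) = \<sigma> * (f $ n * x)" for n x
    by (rule mult_left_commuteI) (simp add: sigma_commute)
  have d1': "f $ a * (d $ Suc 0 * f $ b) = f $ a * (f $ b * d $ Suc 0) - \<sigma> * (f $ a * f $ b)"
    "f $ b * (d $ Suc 0 * f $ a) = f $ b * (f $ a * d $ Suc 0) - \<sigma> * (f $ b * f $ a)"
    using d1[OF assms(2)] d1[OF assms(3)] by (simp_all add: right_diff_distrib s)
  show ?thesis
    unfolding f_Suc[OF assms(2)] f_Suc[OF assms(3)]
    by (simp add: algebra_simps s d1' ba ba')
qed

text \<open>Induction on \<open>a + b\<close>: the formula for \<open>f(u)\<^sup>2\<close>, obtained by conjugating \<open>f\<^sub>1\<^sup>2 = 0\<close> with \<open>d(u)\<close>, yields the case \<open>a = 1\<close>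
  of the next degree, and commuting with \<open>d\<^sub>2\<close> moves one unit between \<open>a\<close> and \<open>b\<close>.\<close>

lemma f_anticommute:
  assumes "a \<ge> 1" "b \<ge> 1"
  shows "f $ a * f $ b + f $ b * f $ a = 0"
proof -
  have "\<forall>a\<ge>1. \<forall>b\<ge>1. a + b = Suc (Suc n) \<longrightarrow> f $ a * f $ b + f $ b * f $ a = 0" for n
  proof (induction n)
    case 0
    have "a = Suc 0 \<and> b = Suc 0" if "a \<ge> 1" "b \<ge> 1" "a + b = Suc (Suc 0)" for a b :: nat
      using that by auto
    moreover have "f $ Suc 0 * f $ Suc 0 = 0" using sq21 f1 by simp
    ultimately show ?case by fastforce
  next
    case (Suc n)
    have G0: "f $ i * f $ j + f $ j * f $ i = 0" if "i + j = Suc (Suc n)" for i j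
      using Suc that by (cases "i = 0 \<or> j = 0") auto
    \<comment> \<open>Adding the convolution to its reversal makes twice this coefficient a sum of
      anticommutators of total degree \<open>n + 2\<close>, all zero by the induction
      hypothesis.\<close>
    have "(f * f) $ Suc (Suc n) = (\<Sum>i=0..Suc (Suc n). f $ i * f $ (Suc (Suc n) - i))"
      by (rule fps_mult_nth)
    moreover have "\<dots> = (\<Sum>i=0..Suc (Suc n). f $ (Suc (Suc n) - i) * f $ i)"
      by (rule sum.reindex_bij_witness[of _ "\<lambda>i. Suc (Suc n) - i" "\<lambda>i. Suc (Suc n) - i"]) auto
    ultimately have "(f * f) $ Suc (Suc n) + (f * f) $ Suc (Suc n) =
      (\<Sum>i=0..Suc (Suc n). f $ i * f $ (Suc (Suc n) - i) + f $ (Suc (Suc n) - i) * f $ i)"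
      by (simp only: sum.distrib)
    also have "\<dots> = 0" by (rule sum.neutral) (use G0 in auto)
    finally have "(f * f) $ Suc (Suc n) = 0" by (rule half)
    then have "\<sigma> * (f $ Suc 0 * f $ Suc (Suc n) + f $ Suc (Suc n) * f $ Suc 0) = 0"
      using arg_cong[OF f_square, of "\<lambda>F. F $ Suc (Suc n)"] by simp
    then have 1: "f $ Suc 0 * f $ Suc (Suc n) + f $ Suc (Suc n) * f $ Suc 0 = 0"
      by (metis sigma_sigma(2) mult_zero_right)
    have "f $ a * f $ b + f $ b * f $ a = 0" if "a \<ge> 1" "b \<ge> 1" "a + b = Suc (Suc (Suc n))" for a b
      using that
    proof (induction a arbitrary: b rule: nat_induct_at_least)
      case base
      then show ?case using 1 by simp
    next
      case (Suc a)
      then show ?case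
        using f_anticommute_step[of a b] G0[of a b] Suc.IH[of "Suc b"] by simp
    qed
    then show ?case by blast
  qed
  from this[of "a + b - 2"] show ?thesis using assms by simp
qed

lemma f_square_zero: "f $ a * f $ a = 0"
  by (rule half, cases "a = 0") (simp_all add: f_anticommute)

section \<open>Commutation of \<open>h\<close> with \<open>d\<close>, \<open>e1\<close> and
  \<open>f $ Suc 0\<close>\<close>

lemma h_fps: "h = fps_const e1 * f + f * fps_const e1"
  by (rule fps_ext) (simp add: h_def)

lemma h0 [simp]: "h $ 0 = 0"
  by (simp add: h_def)

text \<open>Moving \<open>d\<close> to the left of \<open>e1\<close> turns \<open>f\<close> into
  \<open>t21\<close>, where \<open>cross\<close> applies; the correction term \<open>f * t12\<close>
  completes \<open>t22\<close> to \<open>d2\<close>.\<close>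

lemma hd: "h * d = fps_const \<sigma> * (d2 - d)"
proof -
  have 1: "d * fps_const e1 - fps_const e1 * d = fps_const \<sigma> * t12"
    using t12_eq by (intro fps_ext) simp
  have 2: "fps_const e1 * t21 + t21 * fps_const e1 = fps_const \<sigma> * (t22 - d)"
    using cross by (intro fps_ext) simp
  have s: "f * (fps_const \<sigma> * G) = fps_const \<sigma> * (f * G)" for G
    using sgn by (auto simp flip: fps_const_neg)
  have "h * d = fps_const e1 * (f * d) + f * (d * fps_const e1) - f * (d * fps_const e1 - fps_const e1 * d)"
    by (simp add: h_fps algebra_simps)
  also have "\<dots> = fps_const \<sigma> * (t22 - d) - fps_const \<sigma> * (f * t12)"
    unfolding 1 s fd 2[symmetric] by (simp add: fd flip: mult.assoc)
  finally show ?thesis by (simp add: d2_def algebra_simps)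
qed

text \<open>In the commutator of \<open>d(u)\<close> with \<open>t_21 g t_12\<close> at
  \<open>w\<close>, the inner terms cancel, and what remains is the commutator of
  \<open>d(u)\<close> with \<open>t_22(w)\<close>. Finally \<open>udiff\<close> is
  cancelled.\<close>

lemma d_iw_d2: "fps_const d * iw d2 = iw d2 * fps_const d"
proof -
  let ?D = "fps_const d" and ?t = "fps_const t21" and ?s = "fps_const t12"
  let ?D' = "iw d" and ?G' = "iw g" and ?t' = "iw t21" and ?s' = "iw t12" and ?u' = "iw t22"
  have "?t' * (?G' * (?D * ?s')) = ?t' * (?D * (?G' * ?s'))"
    by (simp only: mult_left_commuteI[OF const_d_iw_g])
  then have "?D * (?t' * ?G' * ?s') - ?t' * ?G' * ?s' * ?D
    = (?D * ?t' - ?t' * ?D) * ?G' * ?s' + ?t' * ?G' * (?D * ?s' - ?s' * ?D)"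
    by (simp add: algebra_simps)
  moreover have "udiff * (?t' * ?G' * K) = ?t' * ?G' * (udiff * K)" for K
    by (rule mult_left_commuteI[OF udiff_commute])
  ultimately have "udiff * (?D * (?t' * ?G' * ?s') - ?t' * ?G' * ?s' * ?D)
    = (udiff * (?D * ?t' - ?t' * ?D)) * ?G' * ?s' + ?t' * ?G' * (udiff * (?D * ?s' - ?s' * ?D))"
    by (simp add: distrib_left mult.assoc)
  also have "\<dots> = z * (?t * (?D' * ?G') * ?s' - ?t' * (?D * ?G') * ?s') + (?t' * ?G' * z) * (?D * ?s' - ?D' * ?s)"
    unfolding biv11_z by (simp only: left_diff_distrib right_diff_distrib mult.assoc)
  also have "\<dots> = z * (?t * ?s' - ?t' * ?s)"
    unfolding z_commute[of "?t' * ?G'", symmetric]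
    by (simp add: right_diff_distrib mult.assoc const_d_iw_g iw_gd)
      (simp add: iw_gd mult.assoc[of _ ?G' ?D', symmetric] mult.assoc[of ?G' ?D', symmetric])
  also have "\<dots> = udiff * (?D * ?u' - ?u' * ?D)"
    by (simp only: biv11_z)
  finally have "udiff * (?D * ?u' - ?u' * ?D) - udiff * (?D * (?t' * ?G' * ?s') - ?t' * ?G' * ?s' * ?D) = 0"
    by simp
  then have "udiff * (?D * iw d2 - iw d2 * ?D) = 0"
    by (simp add: d2_def f_def iw_diff iw_mult algebra_simps)
  from udiff_eq_0[OF this] show ?thesis by simp
qed

text \<open>By \<open>hd\<close>, \<open>h = \<sigma> (d2 - d) g\<close>, and \<open>d(u)\<close>
  commutes with every factor taken at \<open>w\<close>.\<close>

lemma d_h: "d $ m * h $ n = h $ n * d $ m"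
proof -
  have "h = (h * d) * g" by (simp add: mult.assoc dg)
  then have "iw h = iw (fps_const \<sigma> * (d2 - d) * g)" by (simp only: hd)
  then have h: "iw h = iw (fps_const \<sigma>) * (iw d2 - iw d) * iw g"
    by (simp only: iw_mult iw_diff)
  have s: "iw (fps_const \<sigma>) = 1 \<or> iw (fps_const \<sigma>) = -1"
  proof -
    have "iw (-1) = - (1 :: 'a fps fps)" by (rule fps_ext) simp
    then show ?thesis using sgn iw_one by (auto simp flip: fps_const_neg)
  qed
  have "fps_const d * ((iw d2 - iw d) * iw g) = ((iw d2 - iw d) * iw g) * fps_const d"
  proof -
    have "fps_const d * (iw d2 - iw d) = (iw d2 - iw d) * fps_const d"
      by (simp add: left_diff_distrib right_diff_distrib d_iw_d2 const_d_iw_d)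
    from mult_left_commuteI[OF this, of "iw g"] show ?thesis
      by (simp only: mult.assoc const_d_iw_g)
  qed
  then have "fps_const d * iw h = iw h * fps_const d"
    unfolding h using s by (auto simp: mult.assoc)
  from arg_cong[OF this, of "\<lambda>F. F $ n $ m"] show ?thesis by simp
qed

lemma e1_h: "e1 * h $ n = h $ n * e1"
proof -
  note mult_left_zeroI[OF sq12]
  then show ?thesis using sq12 by (simp add: h_def distrib_left distrib_right mult.assoc)
qed

text \<open>For \<open>n = 1\<close> both sides reduce to \<open>f_1 e_1 f_1\<close> because
  \<open>f_1\<close> squares to zero; \<open>f_Suc\<close> carries the claim upwards since
  \<open>h_1\<close> commutes with \<open>d\<close>.\<close>

lemma h1_f: "h $ Suc 0 * f $ n = f $ n * h $ Suc 0"
proof (cases "n = 0")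
  case False
  then have "1 \<le> n" by simp
  then show ?thesis
  proof (induction n rule: nat_induct_at_least)
    case base
    note mult_left_zeroI[OF f_square_zero]
    then show ?case using f_square_zero[of "Suc 0"] by (simp add: h_def distrib_left distrib_right mult.assoc)
  next
    case (Suc n)
    have dh: "h $ Suc 0 * d $ m = d $ m * h $ Suc 0" for m by (simp add: d_h)
    note dh' = mult_left_commuteI[OF dh] and fh' = mult_left_commuteI[OF Suc.IH]
      and s = mult_left_commuteI[OF sigma_commute[symmetric], of "h $ Suc 0"]
    show ?case
      unfolding f_Suc[OF Suc.hyps]
      by (simp add: left_diff_distrib right_diff_distrib mult.assoc s dh dh' fh' Suc.IH)
  qed
qed simp

text \<open>As \<open>f_1\<close> and \<open>f_n\<close> anticommute, the commutator of
  \<open>f_1\<close> with \<open>h_n\<close> equals that of \<open>h_1\<close> with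
  \<open>f_n\<close>.\<close>

lemma f1_h: "f $ Suc 0 * h $ n = h $ n * f $ Suc 0"
proof (cases "n = 0")
  case False
  have fn: "f $ Suc 0 * f $ n = - (f $ n * f $ Suc 0)"
    using f_anticommute[of 1 n] False by (simp add: eq_neg_iff_add_eq_0)
  note fn' = mult_left_anticommuteI[OF fn]
  have "f $ Suc 0 * (e1 * f $ n) + e1 * (f $ Suc 0 * f $ n) = f $ n * (e1 * f $ Suc 0) + f $ n * (f $ Suc 0 * e1)"
    using h1_f[of n] by (simp add: h_def algebra_simps)
  then show ?thesis
    by (simp add: h_def fn fn' algebra_simps)
qed simp

end


section \<open>Products of anticommuting elements and homogenized polynomials\<close>

definition prodl :: "(nat \<Rightarrow> 'b::monoid_mult) \<Rightarrow> nat \<Rightarrow> 'b" where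
  "prodl F m = prod_list (map F [1..<Suc m])"

lemma prodl_0 [simp]: "prodl F 0 = 1"
  by (simp add: prodl_def)

lemma prodl_Suc [simp]: "prodl F (Suc m) = prodl F m * F (Suc m)"
  by (simp add: prodl_def)

lemma prodl_commute:
  assumes "\<And>i. 1 \<le> i \<Longrightarrow> i \<le> m \<Longrightarrow> x * F i = F i * x"
  shows "x * prodl F m = prodl F m * x"
  using assms
proof (induction m)
  case (Suc m)
  then have 1: "x * prodl F m = prodl F m * x" and 2: "x * F (Suc m) = F (Suc m) * x" by auto
  show ?case by (simp only: prodl_Suc mult.assoc mult_left_commuteI[OF 1] 2)
qed simp

lemma prodl_anticommute:
  fixes x :: "'b::ring_1"
  assumes "\<And>i. 1 \<le> i \<Longrightarrow> i \<le> m \<Longrightarrow> x * F i = - (F i * x)"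
  shows "x * prodl F m = (-1) ^ m * (prodl F m * x)"
  using assms
proof (induction m)
  case (Suc m)
  then have 1: "x * prodl F m = (-1) ^ m * (prodl F m * x)" and 2: "x * F (Suc m) = - (F (Suc m) * x)"
    by auto
  have "x * prodl F (Suc m) = (x * prodl F m) * F (Suc m)" by (simp add: mult.assoc)
  also have "\<dots> = (-1) ^ m * (prodl F m * (x * F (Suc m)))" unfolding 1 by (simp add: mult.assoc)
  finally show ?case unfolding 2 by (simp add: mult.assoc)
qed simp

lemma prodl_mult_zero:
  fixes F :: "nat \<Rightarrow> 'b::ring_1"
  assumes "\<And>i j. 1 \<le> i \<Longrightarrow> 1 \<le> j \<Longrightarrow> F i * F j = - (F j * F i)" "\<And>i. 1 \<le> i \<Longrightarrow> F i * F i = 0"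
    and "1 \<le> i" "i \<le> m"
  shows "prodl F m * F i = 0"
  using assms(4)
proof (induction m)
  case (Suc m)
  show ?case
  proof (cases "i = Suc m")
    case True
    then show ?thesis using assms(2)[OF assms(3)] by (simp add: mult.assoc)
  next
    case False
    then have "prodl F m * F i = 0" using Suc by simp
    then show ?thesis
      using assms(1)[of "Suc m" i] assms(3) by (simp add: mult.assoc) (simp flip: mult.assoc)
  qed
qed (use assms(3) in simp)

lemma mult_prodl_zero:
  fixes F :: "nat \<Rightarrow> 'b::ring_1"
  assumes "\<And>i j. 1 \<le> i \<Longrightarrow> 1 \<le> j \<Longrightarrow> F i * F j = - (F j * F i)" "\<And>i. 1 \<le> i \<Longrightarrow> F i * F i = 0"
    and "1 \<le> i" "i \<le> m"
  shows "F i * prodl F m = 0"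
proof -
  have "F i * prodl F m = (-1) ^ m * (prodl F m * F i)"
    by (rule prodl_anticommute) (rule assms(1)[OF assms(3)])
  then show ?thesis using prodl_mult_zero[where F = F and i = i and m = m, OF assms] by simp
qed

text \<open>The determinant of a companion matrix, evaluated in an exterior power.\<close>

lemma prodl_companion:
  fixes F :: "nat \<Rightarrow> 'b::ring_1"
  assumes anti: "\<And>i j. 1 \<le> i \<Longrightarrow> 1 \<le> j \<Longrightarrow> F i * F j = - (F j * F i)"
    and sq: "\<And>i. 1 \<le> i \<Longrightarrow> F i * F i = 0"
    and X: "\<And>y. X * y = y * X" and \<alpha>: "\<And>y. \<alpha> * y = y * \<alpha>"
    and c: "\<And>i j. c j * F i = F i * c j" and ck: "c k = 1"
    and inv: "\<beta> * \<alpha> = 1"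
    and rec: "(\<Sum>j\<le>k. c j * F (Suc j)) = 0"
  shows "prodl (\<lambda>i. \<alpha> * F i - X * F (Suc i)) k = (\<Sum>j\<le>k. c j * \<alpha> ^ j * X ^ (k - j)) * prodl F k"
proof (cases k)
  case 0
  then show ?thesis using ck by simp
next
  case (Suc m)
  define b where "b i = \<alpha> * F i - X * F (Suc i)" for i
  define Q where "Q = prodl b m"
  have \<alpha>n: "\<alpha> ^ n * y = y * \<alpha> ^ n" for n y
    by (rule power_commuting_commutes) (rule \<alpha>)
  have pull: "F p * (\<alpha> * y) = \<alpha> * (F p * y)" "F p * (X * y) = X * (F p * y)" "X * (\<alpha> * y) = \<alpha> * (X * y)" for p y
    by (rule mult_left_commuteI[OF \<alpha>[symmetric]] mult_left_commuteI[OF X[symmetric]])+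
  have F2: "F i * F j + F j * F i = 0" if "1 \<le> i" "1 \<le> j" for i j
    using anti[OF that] by simp
  have bb: "b i * b j + b j * b i = 0" if "1 \<le> i" "1 \<le> j" for i j
  proof -
    have "b i * b j + b j * b i = \<alpha> * (\<alpha> * (F i * F j + F j * F i))
      - \<alpha> * (X * (F i * F (Suc j) + F (Suc j) * F i)) - \<alpha> * (X * (F (Suc i) * F j + F j * F (Suc i)))
      + X * (X * (F (Suc i) * F (Suc j) + F (Suc j) * F (Suc i)))"
      unfolding b_def
      by (simp add: left_diff_distrib right_diff_distrib distrib_left mult.assoc pull)
    then show ?thesis using F2 that by simp
  qed
  have b_anti: "b i * b j = - (b j * b i)" if "1 \<le> i" "1 \<le> j" for i j
    using bb[OF that] by (simp add: eq_neg_iff_add_eq_0)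
  have b_sq: "b i * b i = 0" if "1 \<le> i" for i
  proof -
    have "b i * b i = \<alpha> * (\<alpha> * (F i * F i)) - \<alpha> * (X * (F i * F (Suc i) + F (Suc i) * F i))
      + X * (X * (F (Suc i) * F (Suc i)))"
      unfolding b_def
      by (simp add: left_diff_distrib right_diff_distrib distrib_left mult.assoc pull)
    then show ?thesis using F2[of i "Suc i"] sq that by simp
  qed
  \<comment> \<open>\<open>Q\<close> annihilates each of its own factors \<open>b i\<close>. Behind
    \<open>Q\<close>, the index of \<open>F\<close> may therefore be raised while one
    \<open>\<alpha>\<close> is exchanged for an \<open>X\<close>.\<close>
  have shift: "\<alpha> * (Q * F i) = X * (Q * F (Suc i))" if "1 \<le> i" "i \<le> m" for i
  proof -
    have "Q * b i = 0" unfolding Q_def by (rule prodl_mult_zero[OF b_anti b_sq that])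
    moreover have "Q * b i = \<alpha> * (Q * F i) - X * (Q * F (Suc i))"
      by (simp add: b_def right_diff_distrib mult_left_commuteI[OF \<alpha>[of Q, symmetric]]
          mult_left_commuteI[OF X[of Q, symmetric]])
    ultimately show ?thesis by simp
  qed
  have shifts: "\<alpha> ^ n * (Q * F (Suc j)) = X ^ n * (Q * F (Suc j + n))" if "j + n \<le> m" for j n
    using that
  proof (induction n)
    case (Suc n)
    have "\<alpha> ^ Suc n * (Q * F (Suc j)) = \<alpha> * (X ^ n * (Q * F (Suc j + n)))"
      using Suc by (simp add: mult.assoc)
    also have "\<dots> = X ^ n * (\<alpha> * (Q * F (Suc j + n)))" by (rule mult_left_commuteI[OF \<alpha>])
    also have "\<alpha> * (Q * F (Suc j + n)) = X * (Q * F (Suc j + Suc n))"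
      using shift[of "Suc j + n"] Suc.prems by simp
    finally show ?case by (simp add: mult.assoc power_commutes flip: mult.assoc[of "X ^ n" X])
  qed simp
  \<comment> \<open>From right to left, the part \<open>X * F (Suc i)\<close> of each factor meets
    its own copy and dies, so only the \<open>\<alpha>\<close> parts survive.\<close>
  have QF: "prodl b n * F (Suc n) = \<alpha> ^ n * (prodl F n * F (Suc n))" for n
  proof (induction n)
    case (Suc n)
    have "prodl b (Suc n) * F (Suc (Suc n)) = prodl b n * (b (Suc n) * F (Suc (Suc n)))"
      by (simp add: mult.assoc)
    also have "b (Suc n) * F (Suc (Suc n)) = \<alpha> * (F (Suc n) * F (Suc (Suc n)))"
      by (simp add: b_def left_diff_distrib mult.assoc sq)
    also have "prodl b n * \<dots> = \<alpha> * (prodl b n * F (Suc n) * F (Suc (Suc n)))"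
      by (simp add: mult.assoc mult_left_commuteI[OF \<alpha>[of "prodl b n", symmetric]])
    finally show ?case unfolding Suc by (simp add: mult.assoc)
  qed simp
  define P where "P = prodl F k"
  have QFk: "Q * F k = \<alpha> ^ m * P"
    unfolding Q_def P_def Suc QF by simp
  have cQ: "c j * Q = Q * c j" for j
  proof -
    have "c j * b i = b i * c j" for i
      unfolding b_def right_diff_distrib left_diff_distrib mult.assoc
      by (simp only: c mult_left_commuteI[OF \<alpha>[of "c j", symmetric]] mult_left_commuteI[OF X[of "c j", symmetric]])
    then show ?thesis unfolding Q_def by (rule prodl_commute)
  qed
  have "F (Suc k) + (\<Sum>j<k. c j * F (Suc j)) = 0"
    using rec ck by (simp add: atMost_Suc Suc lessThan_Suc_atMost add.commute)
  then have Fk: "F (Suc k) = - (\<Sum>j<k. c j * F (Suc j))" by (simp add: eq_neg_iff_add_eq_0)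
  have summand: "\<alpha> ^ m * (X * (c j * (Q * F (Suc j)))) = c j * \<alpha> ^ j * X ^ (k - j) * (Q * F k)" if "j < k" for j
  proof -
    have j: "j + (m - j) \<le> m" "Suc j + (m - j) = k" "k - j = Suc (m - j)" "m = j + (m - j)"
      using that Suc by auto
    have "\<alpha> ^ m * (X * (c j * (Q * F (Suc j)))) = X * (c j * (\<alpha> ^ m * (Q * F (Suc j))))"
      by (simp add: mult_left_commuteI[OF \<alpha>n[of m X]] mult_left_commuteI[OF \<alpha>n[of m "c j"]])
    also have "\<alpha> ^ m * (Q * F (Suc j)) = \<alpha> ^ j * (X ^ (m - j) * (Q * F k))"
      using shifts[OF j(1), unfolded j(2)] arg_cong[OF j(4), of "power \<alpha>"]
      by (simp add: mult.assoc power_add)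
    also have "X * (c j * \<dots>) = c j * (\<alpha> ^ j * (X * (X ^ (m - j) * (Q * F k))))"
      by (simp add: mult_left_commuteI[OF X[of "c j"]] mult_left_commuteI[OF X[of "\<alpha> ^ j"]])
    finally show ?thesis by (simp add: j(3) mult.assoc)
  qed
  \<comment> \<open>The extra power of \<open>\<alpha>\<close> lets \<open>shifts\<close> bring
    every term of the last factor to a multiple of \<open>Q * F k\<close>, after
    \<open>F (Suc k)\<close> has been eliminated by \<open>rec\<close>. It is cancelled at the end
    with \<open>\<beta>\<close>.\<close>
  have "\<alpha> ^ m * prodl b k = \<alpha> ^ m * (\<alpha> * (Q * F k)) - \<alpha> ^ m * (X * (Q * F (Suc k)))"
    by (simp add: Suc Q_def b_def[of "Suc m"] right_diff_distrib mult_left_commuteI[OF \<alpha>[of "prodl b m", symmetric]]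
        mult_left_commuteI[OF X[of "prodl b m", symmetric]])
  also have "Q * F (Suc k) = - (\<Sum>j<k. c j * (Q * F (Suc j)))"
    unfolding Fk by (simp add: sum_distrib_left mult_left_commuteI[OF cQ[symmetric]])
  also have "\<alpha> ^ m * (\<alpha> * (Q * F k)) - \<alpha> ^ m * (X * - (\<Sum>j<k. c j * (Q * F (Suc j))))
    = c k * \<alpha> ^ k * X ^ (k - k) * (Q * F k) + (\<Sum>j<k. c j * \<alpha> ^ j * X ^ (k - j) * (Q * F k))"
  proof -
    have "\<alpha> ^ m * (X * (\<Sum>j<k. c j * (Q * F (Suc j)))) = (\<Sum>j<k. c j * \<alpha> ^ j * X ^ (k - j) * (Q * F k))"
      unfolding sum_distrib_left by (rule sum.cong) (use summand in auto)
    moreover have "\<alpha> ^ m * (\<alpha> * (Q * F k)) = c k * \<alpha> ^ k * X ^ (k - k) * (Q * F k)"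
      unfolding ck using \<alpha>n[of m \<alpha>] by (simp add: Suc flip: mult.assoc)
    ultimately show ?thesis by simp
  qed
  also have "\<dots> = (\<Sum>j\<le>k. c j * \<alpha> ^ j * X ^ (k - j)) * (Q * F k)"
    unfolding lessThan_Suc_atMost[symmetric] sum.lessThan_Suc distrib_right sum_distrib_right
    by (simp add: add.commute)
  also have "\<dots> = \<alpha> ^ m * ((\<Sum>j\<le>k. c j * \<alpha> ^ j * X ^ (k - j)) * P)"
    unfolding QFk by (simp add: mult_left_commuteI[OF \<alpha>n])
  finally have "\<beta> ^ m * (\<alpha> ^ m * prodl b k) = \<beta> ^ m * (\<alpha> ^ m * ((\<Sum>j\<le>k. c j * \<alpha> ^ j * X ^ (k - j)) * P))"
    by simp
  moreover have "\<beta> ^ m * \<alpha> ^ m = 1"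
    using left_right_inverse_power[OF inv] .
  then have "\<beta> ^ m * (\<alpha> ^ m * y) = y" for y by (simp flip: mult.assoc)
  ultimately show ?thesis by (simp add: P_def b_def[abs_def])
qed

text \<open>\<open>homog \<beta> p k\<close> is \<open>u\<^bsup>-k\<^esup> p(u \<beta>)\<close>; its value at \<open>\<beta> = 1 - a u\<^sup>-\<^sup>1\<close> is
  \<open>u\<^bsup>-k\<^esup> p(u - a)\<close>.\<close>

definition homog :: "complex fps \<Rightarrow> complex poly \<Rightarrow> nat \<Rightarrow> complex fps" where
  "homog \<beta> p k = (\<Sum>j\<le>k. fps_const (coeff p j) * \<beta> ^ j * fps_X ^ (k - j))"

section \<open>Homogenized polynomials and their quotients\<close>

lemma homog_diff: "homog \<beta> (p - q) k = homog \<beta> p k - homog \<beta> q k"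
  by (simp add: homog_def sum_subtractf algebra_simps flip: fps_const_sub)

lemma homog_1_nth: "homog 1 p k $ n = (if n \<le> k then coeff p (k - n) else 0)"
proof -
  have "homog 1 p k $ n = (\<Sum>j\<le>k. if n = k - j then coeff p j else 0)"
    by (simp add: homog_def fps_sum_nth fps_X_power_nth if_distrib cong: if_cong)
  also have "\<dots> = (\<Sum>j\<le>k. if j = k - n then (if n \<le> k then coeff p j else 0) else 0)"
    by (intro sum.cong) auto
  finally show ?thesis by simp
qed

lemma homog_1_reflect:
  assumes "degree p \<le> k"
  shows "homog 1 p k = fps_X ^ (k - degree p) * fps_of_poly (reflect_poly p)"
  using assms
  by (intro fps_ext) (auto simp: homog_1_nth fps_X_power_mult_nth coeff_reflect_poly coeff_eq_0)

lemma homog_1_mult: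
  assumes "degree p \<le> k" "degree q \<le> l"
  shows "homog 1 (p * q) (k + l) = homog 1 p k * homog 1 q l"
proof (cases "p = 0 \<or> q = 0")
  case True
  then show ?thesis by (auto simp: homog_def)
next
  case False
  have "degree (p * q) \<le> k + l" using assms degree_mult_le[of p q] by linarith
  then have "homog 1 (p * q) (k + l)
    = fps_X ^ (k + l - degree (p * q)) * (fps_of_poly (reflect_poly p) * fps_of_poly (reflect_poly q))"
    by (simp only: homog_1_reflect reflect_poly_mult fps_of_poly_mult)
  also have "k + l - degree (p * q) = (k - degree p) + (l - degree q)"
    using assms False degree_mult_eq[of p q] by simp
  finally show ?thesis
    unfolding homog_1_reflect[OF assms(1)] homog_1_reflect[OF assms(2)] power_add by (simp only: mult_ac)
qed

text \<open>Expand \<open>p(u - a)\<close> in powers of \<open>u - a\<close>, using that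
  \<open>u^-k (u - a)^j\<close> is \<open>(1 - a X)^j X^(k - j)\<close>.\<close>

lemma homog_shift:
  assumes "degree p \<le> k"
  shows "homog (1 - fps_const (of_int a) * fps_X) p k = homog 1 (shift_poly a p) k"
proof -
  let ?q = "[:- of_int a, 1:] :: complex poly"
  have "shift_poly a p = (\<Sum>j\<le>degree p. smult (coeff p j) (?q ^ j))"
    by (simp add: shift_poly_def pcompose_altdef poly_altdef degree_map_poly coeff_map_poly)
  also have "\<dots> = (\<Sum>j\<le>k. smult (coeff p j) (?q ^ j))"
    by (rule sum.mono_neutral_left) (use assms in \<open>auto simp: coeff_eq_0\<close>)
  finally have "coeff (shift_poly a p) n = (\<Sum>j\<le>k. coeff p j * coeff (?q ^ j) n)" for n
    by (simp add: coeff_sum)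
  then have "homog 1 (shift_poly a p) k = (\<Sum>j\<le>k. fps_const (coeff p j) * homog 1 (?q ^ j) k)"
    by (intro fps_ext) (simp add: homog_1_nth fps_sum_nth)
  also have "\<dots> = (\<Sum>j\<le>k. fps_const (coeff p j) * (1 - fps_const (of_int a) * fps_X) ^ j * fps_X ^ (k - j))"
  proof (rule sum.cong)
    fix j assume "j \<in> {..k}"
    then have "homog 1 (?q ^ j) k = fps_X ^ (k - j) * fps_of_poly (reflect_poly ?q) ^ j"
      by (simp add: homog_1_reflect degree_power_eq reflect_poly_power fps_of_poly_power)
    also have "fps_of_poly (reflect_poly ?q) = 1 - fps_const (of_int a) * fps_X"
      by (rule fps_ext) (auto simp: coeff_reflect_poly coeff_pCons fps_X_def split: nat.splits)
    finally show "fps_const (coeff p j) * homog 1 (?q ^ j) k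
      = fps_const (coeff p j) * (1 - fps_const (of_int a) * fps_X) ^ j * fps_X ^ (k - j)"
      by (simp only: mult_ac)
  qed simp
  finally show ?thesis by (simp add: homog_def)
qed

lemma expand_at_infinity_homog:
  assumes "degree p = k" "degree q = k"
  shows "expand_at_infinity p q = homog 1 p k / homog 1 q k"
proof -
  have "homog 1 p k = fps_of_poly (reflect_poly p)" "homog 1 q k = fps_of_poly (reflect_poly q)"
    using assms homog_1_reflect[of p k] homog_1_reflect[of q k] by simp_all
  then show ?thesis unfolding expand_at_infinity_def assms by simp
qed

lemma expand_shift:
  assumes "degree p = k"
  shows "expand_at_infinity (shift_poly a p) p = homog (1 - fps_const (of_int a) * fps_X) p k / homog 1 p k"
proof -
  have "degree (shift_poly a p) = k" using assms by (simp add: shift_poly_def degree_pcompose)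
  then show ?thesis using assms by (simp add: expand_at_infinity_homog homog_shift)
qed

text \<open>The right-hand side of the first hypothesis has no coefficients beyond \<open>k\<close>,
  so the expansion of \<open>\<chi> / \<phi>\<close> is a linearly recurrent sequence with
  characteristic polynomial \<open>\<phi>\<close>.\<close>

lemma homog_quotient_recurrence:
  assumes "H * homog 1 \<phi> k = homog 1 \<chi> k" "r \<ge> 1"
  shows "(\<Sum>j\<le>k. coeff \<phi> j * H $ (j + r)) = 0"
proof -
  have "0 = (H * homog 1 \<phi> k) $ (k + r)"
    unfolding assms(1) using assms(2) by (simp add: homog_1_nth)
  also have "\<dots> = (\<Sum>i=0..k + r. H $ i * homog 1 \<phi> k $ (k + r - i))"
    by (rule fps_mult_nth)
  also have "\<dots> = (\<Sum>i=r..k + r. H $ i * homog 1 \<phi> k $ (k + r - i))"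
    by (rule sum.mono_neutral_right) (auto simp: homog_1_nth)
  also have "\<dots> = (\<Sum>j\<le>k. coeff \<phi> j * H $ (j + r))"
    by (rule sum.reindex_bij_witness[of _ "\<lambda>j. j + r" "\<lambda>i. i - r"]) (auto simp: homog_1_nth)
  finally show ?thesis by simp
qed

lemma homog_quotient_coeff:
  assumes "H * homog 1 \<phi> k = homog 1 \<chi> k" "m \<le> k"
  shows "(\<Sum>i\<le>k - m. coeff \<phi> (m + i) * H $ i) = coeff \<chi> m"
proof -
  have "coeff \<chi> m = (H * homog 1 \<phi> k) $ (k - m)"
    unfolding assms(1) using assms(2) by (simp add: homog_1_nth)
  also have "\<dots> = (\<Sum>i=0..k - m. H $ i * homog 1 \<phi> k $ (k - m - i))"
    by (rule fps_mult_nth)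
  also have "\<dots> = (\<Sum>i\<le>k - m. coeff \<phi> (m + i) * H $ i)"
    by (rule sum.cong) (use assms(2) in \<open>auto simp: homog_1_nth\<close>)
  finally show ?thesis by simp
qed

text \<open>Iterating \<open>step\<close> expresses \<open>\<beta> ^ j * y 1\<close> through
  \<open>y (Suc j)\<close> and coefficients of \<open>H\<close>. Weighted with the coefficients of
  \<open>\<phi>\<close> and summed, the first parts cancel by \<open>rec\<close> and the second ones
  assemble to \<open>\<chi>\<close>.\<close>

lemma homog_quotient_evaluate:
  fixes y :: "nat \<Rightarrow> complex fps"
  assumes H: "H * homog 1 \<phi> k = homog 1 \<chi> k" and H0: "H $ 0 = 0"
    and step: "\<And>b. b \<ge> 1 \<Longrightarrow> \<beta> * y b = fps_X * y (Suc b) + c * fps_X * fps_const (H $ b)"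
    and rec: "(\<Sum>j\<le>k. fps_const (coeff \<phi> j) * y (Suc j)) = 0"
  shows "homog \<beta> \<phi> k * y 1 = c * homog \<beta> \<chi> k"
proof -
  \<comment> \<open>The summand for \<open>i = 0\<close> is zero, as \<open>H $ 0 = 0\<close>;
    including it gives the sums the range of \<open>homog_quotient_coeff\<close>.\<close>
  have iter: "\<beta> ^ j * y 1 = fps_X ^ j * y (Suc j)
    + c * (\<Sum>i\<le>j. \<beta> ^ (j - i) * fps_X ^ i * fps_const (H $ i))" for j
  proof (induction j)
    case (Suc j)
    have "\<beta> ^ Suc j * y 1 = \<beta> * (\<beta> ^ j * y 1)" by simp
    also have "\<dots> = fps_X ^ j * (\<beta> * y (Suc j))
      + c * (\<Sum>i\<le>j. \<beta> * (\<beta> ^ (j - i) * fps_X ^ i * fps_const (H $ i)))"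
      unfolding Suc sum_distrib_left[symmetric] by (simp add: algebra_simps)
    also have "(\<Sum>i\<le>j. \<beta> * (\<beta> ^ (j - i) * fps_X ^ i * fps_const (H $ i)))
      = (\<Sum>i\<le>j. \<beta> ^ (Suc j - i) * fps_X ^ i * fps_const (H $ i))"
      by (rule sum.cong) (auto simp: Suc_diff_le)
    finally show ?case by (simp add: step algebra_simps)
  qed (simp add: H0)
  have "homog \<beta> \<phi> k * y 1 = (\<Sum>j\<le>k. fps_const (coeff \<phi> j) * fps_X ^ (k - j) * (\<beta> ^ j * y 1))"
    unfolding homog_def sum_distrib_right by (simp only: mult_ac)
  also have "\<dots> = (\<Sum>j\<le>k. fps_X ^ k * (fps_const (coeff \<phi> j) * y (Suc j)))
    + c * (\<Sum>j\<le>k. \<Sum>i\<le>j. fps_const (coeff \<phi> j * H $ i) * \<beta> ^ (j - i) * fps_X ^ (k - j + i))"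
    unfolding iter sum_distrib_left sum.distrib[symmetric]
  proof (rule sum.cong)
    fix j assume "j \<in> {..k}"
    then have "fps_X ^ k = fps_X ^ (k - j) * (fps_X ^ j :: complex fps)"
      by (simp flip: power_add)
    then show "fps_const (coeff \<phi> j) * fps_X ^ (k - j) *
      (fps_X ^ j * y (Suc j) + (\<Sum>i\<le>j. c * (\<beta> ^ (j - i) * fps_X ^ i * fps_const (H $ i)))) =
      fps_X ^ k * (fps_const (coeff \<phi> j) * y (Suc j)) +
      (\<Sum>i\<le>j. c * (fps_const (coeff \<phi> j * H $ i) * \<beta> ^ (j - i) * fps_X ^ (k - j + i)))"
      by (simp only: distrib_left sum_distrib_left fps_const_mult[symmetric] power_add mult_ac)
  qed simp
  also have "(\<Sum>j\<le>k. fps_X ^ k * (fps_const (coeff \<phi> j) * y (Suc j))) = 0"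
    using rec by (simp flip: sum_distrib_left)
  \<comment> \<open>Regroup by the exponent \<open>m = j - i\<close> of
    \<open>\<beta>\<close>.\<close>
  also have "(\<Sum>j\<le>k. \<Sum>i\<le>j. fps_const (coeff \<phi> j * H $ i) * \<beta> ^ (j - i) * fps_X ^ (k - j + i))
    = (\<Sum>m\<le>k. \<Sum>i\<le>k - m. fps_const (coeff \<phi> (m + i) * H $ i) * \<beta> ^ m * fps_X ^ (k - m))"
    unfolding sum.Sigma[OF finite_atMost ballI[OF finite_atMost]]
    by (rule sum.reindex_bij_witness[of _ "\<lambda>(m, i). (m + i, i)" "\<lambda>(j, i). (j - i, i)"]) auto
  also have "\<dots> = homog \<beta> \<chi> k"
    unfolding homog_def
  proof (rule sum.cong)
    fix m assume "m \<in> {..k}"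
    have "fps_const (sum f A) = (\<Sum>i\<in>A. fps_const (f i))" for f :: "nat \<Rightarrow> complex" and A
      by (rule fps_ext) (simp add: fps_sum_nth)
    from this[of "\<lambda>i. coeff \<phi> (m + i) * H $ i" "{..k - m}"]
    have "(\<Sum>i\<le>k - m. fps_const (coeff \<phi> (m + i) * H $ i)) = fps_const (coeff \<chi> m)"
      using homog_quotient_coeff[OF H, of m] \<open>m \<in> {..k}\<close> by simp
    then show "(\<Sum>i\<le>k - m. fps_const (coeff \<phi> (m + i) * H $ i) * \<beta> ^ m * fps_X ^ (k - m))
      = fps_const (coeff \<chi> m) * \<beta> ^ m * fps_X ^ (k - m)"
      by (simp only: flip: sum_distrib_right)
  qed simp
  finally show ?thesis by simp
qed

text \<open>Nondegeneracy of the Hankel form of \<open>H\<close>: a Bezout identity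
  \<open>x \<phi> + y \<chi> = 1\<close> makes a combination of \<open>H\<close> with polynomial
  coefficients equal to \<open>1 / \<phi>\<close>, whose expansion begins with
  \<open>u^-k\<close>.\<close>

lemma homog_quotient_dual:
  assumes H: "H * homog 1 \<phi> k = homog 1 \<chi> k" and "coprime \<phi> \<chi>" and \<phi>: "degree \<phi> = k" "lead_coeff \<phi> = 1"
    and \<chi>: "degree \<chi> \<le> k"
  obtains N p where "\<And>l. 1 \<le> l \<Longrightarrow> l \<le> k \<Longrightarrow>
    (\<Sum>a\<le>N. p a * H $ (a + l)) = (if l = k then 1 else 0)"
proof -
  obtain x y where xy: "x * \<phi> + y * \<chi> = 1"
    using bezout_coefficients_fst_snd[of \<phi> \<chi>] assms(2) by (auto simp: coprime_iff_gcd_eq_1)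
  define N where "N = max (degree x) (degree y)"
  have unit: "homog 1 \<phi> k $ 0 = 1" using \<phi> by (simp add: homog_1_nth)
  have "homog 1 x N * homog 1 \<phi> k + homog 1 y N * homog 1 \<chi> k = homog 1 (x * \<phi> + y * \<chi>) (N + k)"
  proof -
    have "homog 1 (p + q) n = homog 1 p n + homog 1 q n" for p q n
      by (rule fps_ext) (simp add: homog_1_nth)
    then show ?thesis using \<phi> \<chi> by (simp add: homog_1_mult N_def)
  qed
  also have "\<dots> = fps_X ^ (N + k)"
    unfolding xy by (rule fps_ext) (auto simp: homog_1_nth fps_X_power_nth)
  finally have "(homog 1 x N + homog 1 y N * H) * homog 1 \<phi> k = fps_X ^ (N + k)"
    by (simp add: distrib_right mult.assoc H)
  then have "(homog 1 x N + homog 1 y N * H) * (homog 1 \<phi> k * inverse (homog 1 \<phi> k))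
    = fps_X ^ (N + k) * inverse (homog 1 \<phi> k)"
    by (simp only: flip: mult.assoc)
  then have eq: "homog 1 x N + homog 1 y N * H = fps_X ^ (N + k) * inverse (homog 1 \<phi> k)"
    using unit by (simp add: inverse_mult_eq_1')
  show thesis
  proof
    fix l assume l: "1 \<le> l" "l \<le> k"
    \<comment> \<open>The functional \<open>p\<close> is \<open>coeff y\<close>. Coefficient
      \<open>N + l\<close> lies beyond the end of \<open>homog 1 x N\<close>, so it sees only the
      product with \<open>H\<close>.\<close>
    have "(\<Sum>a\<le>N. coeff y a * H $ (a + l)) = (\<Sum>i=0..N. homog 1 y N $ i * H $ (N + l - i))"
      by (rule sum.reindex_bij_witness[of _ "\<lambda>i. N - i" "\<lambda>a. N - a"])
        (auto simp: homog_1_nth add.commute)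
    also have "\<dots> = (\<Sum>i=0..N + l. homog 1 y N $ i * H $ (N + l - i))"
      by (rule sum.mono_neutral_left) (auto simp: homog_1_nth)
    also have "\<dots> = (homog 1 x N + homog 1 y N * H) $ (N + l)"
      using l by (simp add: fps_mult_nth homog_1_nth)
    also have "\<dots> = (if l = k then 1 else 0)"
      unfolding eq using l unit by (auto simp: fps_X_power_mult_nth)
    finally show "(\<Sum>a\<le>N. coeff y a * H $ (a + l)) = (if l = k then 1 else 0)" .
  qed
qed


section \<open>Endomorphism-valued currents\<close>

text \<open>Since rings are nontrivial in the type class \<^class>\<open>ring_1\<close>, the integers replace the
  endomorphism ring over a trivial group.\<close>

typedef (overloaded) 'v endo =
  "{P :: ('v::ab_group_add \<Rightarrow> 'v) \<times> int.
    (\<forall>x y. fst P (x + y) = fst P x + fst P y) \<and> ((\<exists>x :: 'v. x \<noteq> 0) \<longrightarrow> snd P = 0)}"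
  by (rule exI[of _ "(\<lambda>x. x, 0)"]) simp

setup_lifting type_definition_endo

lift_definition app :: "'v::ab_group_add endo \<Rightarrow> 'v \<Rightarrow> 'v" is fst .

definition Endo :: "('v \<Rightarrow> 'v) \<Rightarrow> 'v::ab_group_add endo" where
  "Endo G = Abs_endo (G, 0)"

text \<open>A nonzero vector forces both integer components to be zero.\<close>

lemma endo_eqI:
  fixes F G :: "'v::ab_group_add endo"
  assumes "(x :: 'v) \<noteq> 0" "\<And>x. app F x = app G x"
  shows "F = G"
  using assms by transfer (auto simp: prod_eq_iff)

lemma app_Endo: "(\<And>x y. G (x + y) = G x + G y) \<Longrightarrow> app (Endo G) = G"
  by (simp add: Endo_def app.rep_eq Abs_endo_inverse)

lemma app_plus [simp]: "app F (x + y) = app F x + app F y"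
  by transfer simp

lemma app_zero [simp]: "app F 0 = 0"
  using app_plus[of F 0 0] by simp

lemma app_uminus [simp]: "app F (- x) = - app F x"
  using app_plus[of F x "- x"] by (simp add: eq_neg_iff_add_eq_0 add.commute)

lemma app_minus [simp]: "app F (x - y) = app F x - app F y"
  using app_plus[of F x "- y"] by simp

instantiation endo :: (ab_group_add) ring_1
begin

lift_definition zero_endo :: "'a endo" is "(\<lambda>x. 0, 0)" by simp
lift_definition one_endo :: "'a endo" is "(\<lambda>x. x, if \<exists>x :: 'a. x \<noteq> 0 then 0 else 1)" by simp
lift_definition plus_endo :: "'a endo \<Rightarrow> 'a endo \<Rightarrow> 'a endo"
  is "\<lambda>F G. (\<lambda>x. fst F x + fst G x, snd F + snd G)"
  by (auto simp: algebra_simps)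
lift_definition uminus_endo :: "'a endo \<Rightarrow> 'a endo" is "\<lambda>F. (\<lambda>x. - fst F x, - snd F)"
  by auto
lift_definition times_endo :: "'a endo \<Rightarrow> 'a endo \<Rightarrow> 'a endo"
  is "\<lambda>F G. (\<lambda>x. fst F (fst G x), snd F * snd G)"
  by auto
definition minus_endo :: "'a endo \<Rightarrow> 'a endo \<Rightarrow> 'a endo" where
  "minus_endo F G = F + - G"

instance
proof
  have "fst P 0 = 0" if "\<forall>x y. fst P (x + y) = fst P x + fst P y" for P :: "('a \<Rightarrow> 'a) \<times> int"
    using that[rule_format, of 0 0] by simp
  note this[simp]
  fix a b c :: "'a endo"
  show "a + b + c = a + (b + c)" by transfer (simp add: algebra_simps)
  show "a + b = b + a" by transfer (simp add: algebra_simps)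
  show "0 + a = a" by transfer simp
  show "- a + a = 0" by transfer simp
  show "a - b = a + - b" by (rule minus_endo_def)
  show "a * b * c = a * (b * c)" by transfer simp
  show "(a + b) * c = a * c + b * c" by transfer (simp add: algebra_simps)
  show "a * (b + c) = a * b + a * c" by transfer (simp add: algebra_simps)
  show "1 * a = a" by transfer (auto simp: prod_eq_iff)
  show "a * 1 = a" by transfer (auto simp: prod_eq_iff)
  show "(0 :: 'a endo) \<noteq> 1" by transfer (auto simp: fun_eq_iff)
qed

end

lemma app_0 [simp]: "app 0 x = 0" by transfer simp
lemma app_1 [simp]: "app 1 x = x" by transfer simp
lemma app_add [simp]: "app (F + G) x = app F x + app G x" by transfer simp
lemma app_neg [simp]: "app (- F) x = - app F x" by transfer simp
lemma app_diff [simp]: "app (F - G) x = app F x - app G x"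
  by (simp only: diff_conv_add_uminus app_add app_neg)
lemma app_mult [simp]: "app (F * G) x = app F (app G x)" by transfer simp
lemma app_sum: "app (sum F A) x = (\<Sum>i\<in>A. app (F i) x)"
  by (induction A rule: infinite_finite_induct) auto
lemma app_neg_1_power: "app ((- 1) ^ n) x = (if even n then x else - x)"
  by simp

definition ann :: "'v::ab_group_add endo fps \<Rightarrow> 'v \<Rightarrow> bool" where
  "ann F x \<longleftrightarrow> (\<forall>n. app (F $ n) x = 0)"

lemma ann_add: "ann F x \<Longrightarrow> ann G x \<Longrightarrow> ann (F + G) x"
  by (simp add: ann_def)

lemma ann_diff: "ann F x \<Longrightarrow> ann G x \<Longrightarrow> ann (F - G) x"
  by (simp add: ann_def)

lemma ann_mult: "ann F x \<Longrightarrow> ann (G * F) x"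
  by (simp add: ann_def fps_mult_nth app_sum)

lemma ann_mult_const: "ann (F * fps_const P) x \<longleftrightarrow> ann F (app P x)"
  by (simp add: ann_def)

text \<open>The situation of the theorem in terms of endomorphisms: \<open>\<kappa>\<close> embeds
  the scalars, \<open>V\<close> is the grading, \<open>irred\<close> expresses stability through the
  generators, and \<open>zeta\<close> is the ratio hypothesis with denominators cleared.\<close>

locale gl11_module = gl11 T "\<kappa> (of_int s)"
  for T :: "idx \<Rightarrow> idx \<Rightarrow> 'v::ab_group_add endo fps" and \<kappa> :: "complex \<Rightarrow> 'v endo" and s :: int +
  fixes V :: "bit \<Rightarrow> 'v set" and v :: 'v and \<zeta>1 \<zeta>2 :: "complex fps" and \<phi> \<psi> :: "complex poly" and k :: nat
  assumes s: "s = 1 \<or> s = -1"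
    and kappa_add: "\<And>a b. \<kappa> (a + b) = \<kappa> a + \<kappa> b"
    and kappa_mult: "\<And>a b. \<kappa> (a * b) = \<kappa> a * \<kappa> b"
    and kappa_1: "\<kappa> 1 = 1"
    and kappa_T: "\<And>c i j n. \<kappa> c * T i j $ n = T i j $ n * \<kappa> c"
    and vs: "vector_space (\<lambda>c. app (\<kappa> c))"
    and V0: "\<And>a. 0 \<in> V a" and V_add: "\<And>a x y. x \<in> V a \<Longrightarrow> y \<in> V a \<Longrightarrow> x + y \<in> V a"
    and V_scale: "\<And>a c x. x \<in> V a \<Longrightarrow> app (\<kappa> c) x \<in> V a"
    and V_Int: "V 0 \<inter> V 1 = {0}" and V_Un: "\<And>x. \<exists>y \<in> V 0. \<exists>z \<in> V 1. x = y + z"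
    and T_par: "\<And>a x i j n. x \<in> V a \<Longrightarrow> app (T i j $ n) x \<in> V (if i = j then a else a + 1)"
    and irred: "\<And>W. \<lbrakk>module.subspace (\<lambda>c. app (\<kappa> c)) W;
       \<And>x. x \<in> W \<Longrightarrow> \<exists>y \<in> W \<inter> V 0. \<exists>z \<in> W \<inter> V 1. x = y + z;
       \<And>i j n x. x \<in> W \<Longrightarrow> app (T i j $ n) x \<in> W\<rbrakk> \<Longrightarrow> W = {0} \<or> W = UNIV"
    and fin: "\<exists>B. finite B \<and> module.span (\<lambda>c. app (\<kappa> c)) B = UNIV"
    and v: "v \<noteq> 0" "\<exists>a. v \<in> V a"
    and e_v: "\<And>n. app (t12 $ n) v = 0"
    and d_v: "\<And>n. app (d $ n) v = app (\<kappa> (\<zeta>1 $ n)) v"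
    and d2_v: "\<And>n. app (d2 $ n) v = app (\<kappa> (\<zeta>2 $ n)) v"
    and zeta_0: "\<zeta>1 $ 0 = 1"
    and \<phi>: "degree \<phi> = k" "lead_coeff \<phi> = 1" and \<psi>: "degree \<psi> = k" "lead_coeff \<psi> = 1"
    and coprime: "coprime \<phi> \<psi>"
    and zeta: "\<zeta>1 * homog 1 \<psi> k = \<zeta>2 * homog 1 \<phi> k"
begin

section \<open>Scalar series, parity and irreducibility\<close>

sublocale vector_space "\<lambda>c. app (\<kappa> c)" by (rule vs)

lemma kappa_0 [simp]: "\<kappa> 0 = 0"
  using kappa_add[of 0 0] by simp

lemma kappa_minus: "\<kappa> (- a) = - \<kappa> a"
  using kappa_add[of a "- a"] by (simp add: eq_neg_iff_add_eq_0 add.commute)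

lemma kappa_sum: "\<kappa> (sum c A) = (\<Sum>i\<in>A. \<kappa> (c i))"
  by (induction A rule: infinite_finite_induct) (auto simp: kappa_add)

lemma kappa_commute: "\<kappa> a * \<kappa> b = \<kappa> b * \<kappa> a"
  by (simp add: mult.commute flip: kappa_mult)

definition K :: "complex fps \<Rightarrow> 'v endo fps" where
  "K c = Abs_fps (\<lambda>n. \<kappa> (c $ n))"

lemma K_nth [simp]: "K c $ n = \<kappa> (c $ n)"
  by (simp add: K_def)

lemma K_add: "K (a + b) = K a + K b"
  by (rule fps_ext) (simp add: kappa_add)

lemma K_diff: "K (a - b) = K a - K b"
  by (rule fps_ext) (simp add: kappa_add kappa_minus flip: add_uminus_conv_diff)

lemma K_mult: "K (a * b) = K a * K b"
  by (rule fps_ext) (simp add: fps_mult_nth kappa_sum kappa_mult)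

lemma K_1 [simp]: "K 1 = 1" and K_X [simp]: "K fps_X = fps_X" and K_0 [simp]: "K 0 = 0"
  and K_const [simp]: "K (fps_const c) = fps_const (\<kappa> c)"
  by (rule fps_ext; simp add: kappa_1)+

lemma K_power: "K (a ^ n) = K a ^ n"
  by (induction n) (simp_all add: K_mult)

lemma K_sum: "K (sum c A) = (\<Sum>i\<in>A. K (c i))"
  by (induction A rule: infinite_finite_induct) (auto simp: K_add)

definition scal :: "'v endo fps \<Rightarrow> bool" where
  "scal F \<longleftrightarrow> (\<forall>c. fps_const (\<kappa> c) * F = F * fps_const (\<kappa> c))"

lemma scal_nth: "scal F \<longleftrightarrow> (\<forall>c n. \<kappa> c * F $ n = F $ n * \<kappa> c)"
  by (auto simp: scal_def fps_eq_iff)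

lemma scal_K:
  assumes "scal F"
  shows "K c * F = F * K c"
proof (rule fps_ext)
  fix n
  have "(K c * F) $ n = (\<Sum>i=0..n. F $ (n - i) * \<kappa> (c $ i))"
    using assms by (simp add: fps_mult_nth scal_nth)
  also have "\<dots> = (\<Sum>i=0..n. F $ i * \<kappa> (c $ (n - i)))"
    by (rule sum.reindex_bij_witness[of _ "\<lambda>i. n - i" "\<lambda>i. n - i"]) auto
  finally show "(K c * F) $ n = (F * K c) $ n" by (simp add: fps_mult_nth)
qed

lemma scal_T: "scal (T i j)"
  by (simp add: scal_nth kappa_T)

lemma scal_mult: "scal F \<Longrightarrow> scal G \<Longrightarrow> scal (F * G)"
  by (simp add: scal_def mult.assoc mult_left_commuteI[of "fps_const _"])

lemma scal_g: "scal g"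
  using commute_inverse[OF _ dg gd] scal_T[of I1 I1] by (simp add: scal_def)

lemma scal_f: "scal f"
  unfolding f_def by (intro scal_mult scal_T scal_g)

lemma kappa_f: "\<kappa> c * f $ n = f $ n * \<kappa> c"
  using scal_f by (simp add: scal_nth)

lemma scal_const: "scal (fps_const F) \<longleftrightarrow> (\<forall>c. \<kappa> c * F = F * \<kappa> c)"
  by (simp add: scal_def)

lemma scal_Kc: "scal (K c)"
  by (simp add: scal_nth kappa_commute)

lemma scal_diff: "scal F \<Longrightarrow> scal G \<Longrightarrow> scal (F - G)"
  by (simp add: scal_def algebra_simps)

text \<open>On \<open>x\<close> the product \<open>F G\<close> acts as \<open>c F\<close>, and
  \<open>c\<close> is an invertible series.\<close>

lemma ann_cancel:
  assumes "ann (F * G) x" "ann (G - K c) x" "c $ 0 \<noteq> 0" "scal F"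
  shows "ann F x"
proof -
  have "F = K (inverse c) * (K c * F)"
    using assms(3) by (simp add: inverse_mult_eq_1 flip: K_mult mult.assoc)
  also have "K c * F = F * G - F * (G - K c)"
    using scal_K[OF assms(4)] by (simp add: algebra_simps)
  finally show ?thesis using assms(1,2) by (metis ann_mult ann_diff)
qed

definition H :: "complex fps" where
  "H = homog 1 (smult (of_int s) (\<psi> - \<phi>)) k / homog 1 \<phi> k"

lemma phi_hat_0: "homog 1 \<phi> k $ 0 = 1" and psi_hat_0: "homog 1 \<psi> k $ 0 = 1"
  using \<phi> \<psi> by (simp_all add: homog_1_nth)

lemma H_phi: "H * homog 1 \<phi> k = homog 1 (smult (of_int s) (\<psi> - \<phi>)) k"
  using phi_hat_0 by (simp add: H_def fps_divide_unit mult.assoc inverse_mult_eq_1)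

lemma homog_smult: "homog \<beta> (smult c p) n = fps_const c * homog \<beta> p n"
  by (simp add: homog_def sum_distrib_left mult.assoc flip: fps_const_mult)

lemma H_0: "H $ 0 = 0"
proof -
  have "(H * homog 1 \<phi> k) $ 0 = 0"
    unfolding H_phi using \<phi> \<psi> by (simp add: homog_1_nth)
  then show ?thesis using phi_hat_0 by simp
qed

text \<open>That is, \<open>H = s_1 (\<zeta>2 / \<zeta>1 - 1)\<close>, the eigenvalue on
  \<open>v\<close> predicted by \<open>hd\<close>.\<close>

lemma H_zeta: "H * \<zeta>1 = fps_const (of_int s) * (\<zeta>2 - \<zeta>1)"
proof -
  have "H * \<zeta>1 * homog 1 \<psi> k = \<zeta>2 * (H * homog 1 \<phi> k)"
    by (simp add: mult.assoc zeta)
  also have "\<dots> = fps_const (of_int s) * (\<zeta>2 - \<zeta>1) * homog 1 \<psi> k"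
    unfolding H_phi homog_smult homog_diff using zeta by (simp add: algebra_simps)
  finally show ?thesis using psi_hat_0 by (metis fps_zero_nth mult_right_cancel zero_neq_one)
qed

lemma h_v: "app (h $ n) v = app (\<kappa> (H $ n)) v"
proof -
  let ?s = "fps_const (\<kappa> (of_int s))"
  have d: "ann (d - K \<zeta>1) v" and d2: "ann (d2 - K \<zeta>2) v"
    by (simp_all add: ann_def d_v d2_v)
  have sh: "scal h"
    unfolding scal_nth h_def by (simp add: algebra_simps kappa_f mult_left_commuteI[OF kappa_f]
        mult_left_commuteI[OF kappa_T] kappa_T)
  have "(h - K H) * d = ?s * (d2 - K \<zeta>2) - ?s * (d - K \<zeta>1) - K H * (d - K \<zeta>1)
    + (?s * (K \<zeta>2 - K \<zeta>1) - K H * K \<zeta>1)"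
    by (simp add: left_diff_distrib hd) (simp add: algebra_simps)
  also have "?s * (K \<zeta>2 - K \<zeta>1) - K H * K \<zeta>1 = K (fps_const (of_int s) * (\<zeta>2 - \<zeta>1) - H * \<zeta>1)"
    by (simp add: K_mult K_diff)
  also have "\<dots> = 0" by (simp add: H_zeta)
  finally have "ann ((h - K H) * d) v"
    using d d2 by (simp add: ann_mult ann_diff)
  from ann_cancel[OF this d] have "ann (h - K H) v"
    using zeta_0 sh scal_Kc scal_diff by simp
  then show ?thesis by (simp add: ann_def)
qed

definition par :: "bit \<Rightarrow> 'v endo \<Rightarrow> bool" where
  "par a F \<longleftrightarrow> (\<forall>b. \<forall>x \<in> V b. app F x \<in> V (a + b))"

lemma V_minus: "x \<in> V a \<Longrightarrow> - x \<in> V a"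
  using V_scale[of x a "-1"] by (simp add: kappa_minus kappa_1)

lemma V_diff: "x \<in> V a \<Longrightarrow> y \<in> V a \<Longrightarrow> x - y \<in> V a"
  using V_add[of x a "- y"] V_minus by simp

lemma par_add: "par a F \<Longrightarrow> par a G \<Longrightarrow> par a (F + G)"
  and par_diff: "par a F \<Longrightarrow> par a G \<Longrightarrow> par a (F - G)"
  and par_neg: "par a F \<Longrightarrow> par a (- F)"
  by (simp_all add: par_def V_add V_diff V_minus)

lemma par_mult: "par a F \<Longrightarrow> par b G \<Longrightarrow> par (a + b) (F * G)"
  unfolding par_def add.assoc app_mult by blast

lemma par_scale: "par a F \<Longrightarrow> par a (\<kappa> c * F)"
  by (simp add: par_def V_scale)

lemma par_0: "par a 0"
  by (simp add: par_def V0)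

lemma par_sum: "(\<And>i. i \<in> A \<Longrightarrow> par a (F i)) \<Longrightarrow> par a (sum F A)"
  by (induction A rule: infinite_finite_induct) (simp_all add: par_0 par_add)

lemma par_T: "par (if i = j then 0 else 1) (T i j $ n)"
  unfolding par_def using T_par[of _ _ i j n]
  by (cases "i = j") (simp_all only: refl if_True if_False add_0_left add.commute[of 1], simp_all)

lemma par_f: "par 1 (f $ n)"
proof (cases "n = 0")
  case False
  then have "1 \<le> n" by simp
  then show ?thesis
  proof (induction n rule: nat_induct_at_least)
    case base
    then show ?case using par_T[of I2 I1 "Suc 0"] f1 by simp
  next
    case (Suc n)
    have "par 0 (d $ m)" for m using par_T[of I1 I1 m] by simp
    then show ?case
      unfolding f_Suc[OF Suc.hyps]
      using par_mult[of 0 _ 1 "f $ n"] par_mult[of 1 "f $ n" 0] Suc.IH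
      by (simp add: par_diff par_neg par_scale)
  qed
qed (simp add: par_0)

text \<open>The common kernel of \<open>\<G>\<close> is graded, since the operators are homogeneous,
  and stable under \<open>e1\<close>, \<open>f $ Suc 0\<close> and \<open>d\<close>, hence under all
  currents. Irreducibility makes it the whole space once it contains a nonzero vector.\<close>

lemma kernel_trivial:
  assumes "\<And>F. F \<in> \<G> \<Longrightarrow> \<exists>a. par a F" "\<And>F c. F \<in> \<G> \<Longrightarrow> \<kappa> c * F = F * \<kappa> c"
    and closed: "\<And>x P. \<lbrakk>\<And>F. F \<in> \<G> \<Longrightarrow> app F x = 0; P \<in> insert e1 (insert (f $ Suc 0) (range (fps_nth d)))\<rbrakk>
      \<Longrightarrow> (\<And>F. F \<in> \<G> \<Longrightarrow> app F (app P x) = 0)"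
    and x: "x \<noteq> 0" "\<And>F. F \<in> \<G> \<Longrightarrow> app F x = 0" and F: "F \<in> \<G>"
  shows "F = 0"
proof -
  define W where "W = {x. \<forall>F\<in>\<G>. app F x = 0}"
  have sub: "subspace W"
  proof (rule subspaceI)
    fix c y assume "y \<in> W"
    then show "app (\<kappa> c) y \<in> W"
      using assms(2) by (auto simp: W_def simp flip: app_mult) (simp flip: assms(2))
  qed (auto simp: W_def)
  have W: "app P y \<in> W" if "y \<in> W" "P = e1 \<or> P = f $ Suc 0 \<or> P = d $ n" for y P n
    using closed[of y P] that by (auto simp: W_def)
  have We: "app e1 y \<in> W" and Wf: "app (t21 $ Suc 0) y \<in> W" and Wd: "app (d $ n) y \<in> W"
    if "y \<in> W" for y n
    using W[OF that] f1 by metis+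
  have sg: "app (\<kappa> (of_int s)) y \<in> W" if "y \<in> W" for y using subspace_scale[OF sub that] .
  have t12: "app (t12 $ n) y \<in> W" if "y \<in> W" for y n
  proof -
    have "t12 $ n = \<kappa> (of_int s) * (d $ n * e1 - e1 * d $ n)" unfolding t12_eq by simp
    then show ?thesis using that by (simp add: sg subspace_diff[OF sub] We Wd)
  qed
  have t21: "app (t21 $ n) y \<in> W" if "y \<in> W" for y n
  proof -
    have "t21 $ n = \<kappa> (of_int s) * (t21 $ Suc 0 * d $ n - d $ n * t21 $ Suc 0)"
      using t21_eq[of n] by (metis minus_diff_eq minus_minus sigma_sigma(2))
    then show ?thesis using that by (simp add: sg subspace_diff[OF sub] Wf Wd)
  qed
  have t22: "app (t22 $ n) y \<in> W" if "y \<in> W" for y n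
  proof -
    have "t22 $ n = d $ n + \<kappa> (of_int s) * (e1 * t21 $ n + t21 $ n * e1)"
      unfolding cross by simp
    then show ?thesis using that by (simp add: sg subspace_add[OF sub] subspace_diff[OF sub] We Wd t21)
  qed
  have "W = {0} \<or> W = UNIV"
  proof (rule irred[OF sub])
    show "app (T i j $ n) y \<in> W" if "y \<in> W" for i j n y
      using that by (cases i; cases j) (auto simp: t12 t21 t22 Wd)
    fix y assume y: "y \<in> W"
    obtain y0 y1 where y01: "y0 \<in> V 0" "y1 \<in> V 1" "y = y0 + y1" using V_Un by blast
    \<comment> \<open>The images of the two parts have opposite parities and add up to zero.\<close>
    have "app F y0 = 0" if F: "F \<in> \<G>" for F
    proof -
      obtain a where "par a F" using assms(1)[OF F] by blast
      then have "app F y0 \<in> V (a + 0)" "app F y1 \<in> V (a + 1)" using y01 unfolding par_def by blast+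
      moreover have "app F y0 = - app F y1"
        using y F y01 by (auto simp: W_def eq_neg_iff_add_eq_0)
      ultimately have "app F y0 \<in> V (a + 0) \<inter> V (a + 1)" using V_minus by force
      then show ?thesis using V_Int by (cases a) auto
    qed
    then have "y0 \<in> W" by (simp add: W_def)
    moreover have "y1 \<in> W" using subspace_diff[OF sub y \<open>y0 \<in> W\<close>] y01 by simp
    ultimately show "\<exists>y0 \<in> W \<inter> V 0. \<exists>y1 \<in> W \<inter> V 1. y = y0 + y1" using y01 by blast
  qed
  moreover have "x \<in> W" using x by (simp add: W_def)
  ultimately have "W = UNIV" using x(1) by auto
  then show ?thesis using F by (intro endo_eqI[OF v(1)]) (auto simp: W_def set_eq_iff)
qed

end

lemma prodl_intertwine:
  fixes x :: "'b::monoid_mult"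
  assumes "\<And>i. 1 \<le> i \<Longrightarrow> x * F i = G i * x"
  shows "x * prodl F m = prodl G m * x"
proof (induction m)
  case (Suc m)
  have "x * prodl F (Suc m) = (x * prodl F m) * F (Suc m)" by (simp add: mult.assoc)
  also have "\<dots> = prodl G m * (x * F (Suc m))" unfolding Suc by (rule mult.assoc)
  finally show ?case using assms[of "Suc m"] by (simp add: mult.assoc)
qed simp

lemma prodl_const: "prodl (\<lambda>i. fps_const (F i)) m = fps_const (prodl F m)"
  by (induction m) simp_all

context gl11_module
begin

section \<open>Scalars \<open>h\<close> and vanishing of the positive coefficients of
  \<open>\<phi>(u) f(u)\<close>\<close>

lemma e1_v: "app e1 v = 0" by (rule e_v)

text \<open>A form of Schur's lemma: the differences commute with the generators and kill
  \<open>v\<close>.\<close>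

lemma h_eq: "h $ n = \<kappa> (H $ n)"
proof -
  define \<G> where "\<G> = range (\<lambda>n. h $ n - \<kappa> (H $ n))"
  have "h $ n - \<kappa> (H $ n) = 0"
  proof (rule kernel_trivial[of \<G> v])
    fix F assume "F \<in> \<G>"
    then obtain n where F: "F = h $ n - \<kappa> (H $ n)" by (auto simp: \<G>_def)
    have e: "par 1 e1" using par_T[of I1 I2 "Suc 0"] by simp
    have "par (1 + 1) (h $ n)"
      unfolding h_def fps_nth_Abs_fps by (intro par_add par_mult e par_f)
    moreover have "par 0 (\<kappa> c)" for c by (simp add: par_def V_scale)
    ultimately show "\<exists>a. par a F" unfolding F by (intro exI[of _ 0] par_diff) simp_all
    show "\<kappa> c * F = F * \<kappa> c" for c
      by (simp add: F h_def algebra_simps kappa_f mult_left_commuteI[OF kappa_f]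
          mult_left_commuteI[OF kappa_T] kappa_T kappa_commute)
    show "app F v = 0" by (simp add: F h_v)
  next
    fix x P F
    assume x: "\<And>F. F \<in> \<G> \<Longrightarrow> app F x = 0"
      and P: "P \<in> insert e1 (insert (f $ Suc 0) (range (fps_nth d)))" and "F \<in> \<G>"
    then obtain n where F: "F = h $ n - \<kappa> (H $ n)" by (auto simp: \<G>_def)
    have *: "F * P = P * F"
      using P by (auto simp: F left_diff_distrib right_diff_distrib e1_h f1_h[unfolded One_nat_def] d_h kappa_T kappa_f)
    show "app F (app P x) = 0"
      using arg_cong[OF *, of "\<lambda>G. app G x"] x[OF \<open>F \<in> \<G>\<close>] by simp
  qed (auto simp: \<G>_def v)
  then show ?thesis by simp
qed

lemma e1_f: "e1 * f $ n + f $ n * e1 = \<kappa> (H $ n)"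
  using h_eq[of n] by (simp add: h_def)

text \<open>The coefficient of \<open>u\<^sup>-\<^sup>r\<close> of \<open>\<phi>(u) f(u)\<close>.\<close>

definition phi_f :: "nat \<Rightarrow> 'v endo" where
  "phi_f r = (\<Sum>j\<le>k. \<kappa> (coeff \<phi> j) * f $ (j + r))"

lemma f_anti: "a \<ge> 1 \<Longrightarrow> b \<ge> 1 \<Longrightarrow> f $ a * f $ b = - (f $ b * f $ a)"
  using f_anticommute[of a b] by (simp add: eq_neg_iff_add_eq_0)

lemma phi_f_f_anti: "a \<ge> 1 \<Longrightarrow> r \<ge> 1 \<Longrightarrow> phi_f r * f $ a = - (f $ a * phi_f r)"
  by (simp add: phi_f_def sum_distrib_left sum_distrib_right mult.assoc f_anti[of _ a]
      mult_left_commuteI[OF kappa_f[symmetric]] flip: sum_negf)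

lemma kappa_phi_f: "\<kappa> c * phi_f r = phi_f r * \<kappa> c"
proof -
  have "\<kappa> c * (\<kappa> b * f $ n) = \<kappa> b * f $ n * \<kappa> c" for b n
    by (simp only: mult_left_commuteI[OF kappa_commute[of c b]] mult.assoc kappa_f[of c])
  then show ?thesis
    unfolding phi_f_def sum_distrib_left sum_distrib_right by (intro sum.cong refl)
qed

lemma phi_f_anti:
  assumes "a \<ge> 1" "r \<ge> 1"
  shows "phi_f r * phi_f a = - (phi_f a * phi_f r)"
proof -
  have "phi_f r * (\<kappa> c * f $ (j + a)) = - (\<kappa> c * f $ (j + a) * phi_f r)" for c j
    using assms by (simp add: mult_left_commuteI[OF kappa_phi_f[symmetric]] phi_f_f_anti mult.assoc)
  then show ?thesis
    unfolding phi_f_def[of a] sum_distrib_left sum_distrib_right sum_negf[symmetric]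
    by (intro sum.cong refl)
qed

lemma phi_f_square:
  assumes "r \<ge> 1"
  shows "phi_f r * phi_f r = 0"
  by (rule half) (use phi_f_anti[OF assms assms] in \<open>simp only: eq_neg_iff_add_eq_0\<close>)

lemma phi_f_e1:
  assumes "r \<ge> 1"
  shows "phi_f r * e1 = - (e1 * phi_f r)"
proof -
  have "e1 * phi_f r + phi_f r * e1 = (\<Sum>j\<le>k. \<kappa> (coeff \<phi> j) * (e1 * f $ (j + r) + f $ (j + r) * e1))"
    by (simp add: phi_f_def sum_distrib_left sum_distrib_right mult.assoc distrib_left sum.distrib
        mult_left_commuteI[OF kappa_T[symmetric]])
  also have "\<dots> = \<kappa> (\<Sum>j\<le>k. coeff \<phi> j * H $ (j + r))"
    by (simp add: e1_f kappa_sum kappa_mult)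
  also have "\<dots> = 0"
    using homog_quotient_recurrence[OF H_phi assms] by simp
  finally show ?thesis by (simp add: eq_neg_iff_add_eq_0 add.commute)
qed

lemma d_phi_f:
  assumes "r \<ge> 1"
  shows "d $ Suc m * phi_f r - phi_f r * d $ Suc m - (d $ m * phi_f (Suc r) - phi_f (Suc r) * d $ m)
    = - (\<kappa> (of_int s) * (phi_f r * d $ m))"
proof -
  have "d $ Suc m * phi_f r - phi_f r * d $ Suc m - (d $ m * phi_f (Suc r) - phi_f (Suc r) * d $ m)
    = (\<Sum>j\<le>k. \<kappa> (coeff \<phi> j) * (d $ Suc m * f $ (j + r) - f $ (j + r) * d $ Suc m
      - (d $ m * f $ Suc (j + r) - f $ Suc (j + r) * d $ m)))"
    by (simp add: phi_f_def sum_distrib_left sum_distrib_right mult.assoc right_diff_distrib sum_subtractf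
        mult_left_commuteI[OF kappa_T[symmetric]])
  also have "\<dots> = (\<Sum>j\<le>k. \<kappa> (coeff \<phi> j) * - (\<kappa> (of_int s) * (f $ (j + r) * d $ m)))"
    by (rule sum.cong) (use assms d_f_coeff in auto)
  also have "\<dots> = - (\<kappa> (of_int s) * (phi_f r * d $ m))"
    by (simp add: phi_f_def sum_distrib_left sum_distrib_right mult.assoc sum_negf
        mult_left_commuteI[OF kappa_commute])
  finally show ?thesis .
qed

text \<open>Take a nonzero subspace of least dimension stable under all \<open>phi_f r\<close>. The
  image of such a square-zero operator in it is stable and proper, hence zero by minimality.\<close>

lemma phi_f_common_kernel: "\<exists>x. x \<noteq> 0 \<and> (\<forall>r\<ge>1. app (phi_f r) x = 0)"
proof -
  \<comment> \<open>A basis is extracted and shown finite, which makes dimensions available.\<close>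
  obtain B where "B \<subseteq> UNIV" "independent B" "UNIV \<subseteq> span B"
    by (rule maximal_independent_subset)
  then have B: "independent B" "span B = UNIV" by auto
  obtain B0 where "finite B0" "span B0 = UNIV" using fin by blast
  then have "finite B"
    using independent_span_bound[of B0 B] B by simp
  then interpret finite_dimensional_vector_space "\<lambda>c. app (\<kappa> c)" B
    using B by unfold_locales auto
  define P where "P U \<longleftrightarrow> subspace U \<and> U \<noteq> {0} \<and> (\<forall>r\<ge>1. \<forall>x\<in>U. app (phi_f r) x \<in> U)" for U
  have "P UNIV" using v(1) by (auto simp: P_def)
  then obtain U where U: "P U" and min: "\<And>W. P W \<Longrightarrow> dim U \<le> dim W"
    using ex_has_least_nat[of P UNIV dim] by blast
  have sU: "subspace U" and U0: "U \<noteq> {0}" using U by (auto simp: P_def)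
  have "app (phi_f r) x = 0" if r: "r \<ge> 1" and x: "x \<in> U" for r x
  proof (rule ccontr)
    assume nz: "app (phi_f r) x \<noteq> 0"
    define W where "W = app (phi_f r) ` U"
    have sW: "subspace W"
    proof (rule subspaceI)
      show "0 \<in> W" using subspace_0[OF sU] by (force simp: W_def)
      show "y + z \<in> W" if yz: "y \<in> W" "z \<in> W" for y z
      proof -
        obtain y' z' where "y' \<in> U" "z' \<in> U" "y = app (phi_f r) y'" "z = app (phi_f r) z'"
          using yz by (auto simp: W_def)
        then show ?thesis
          unfolding W_def by (intro image_eqI[of _ _ "y' + z'"]) (simp_all add: subspace_add[OF sU])
      qed
      show "app (\<kappa> c) y \<in> W" if y: "y \<in> W" for c y
      proof -
        obtain y' where "y' \<in> U" "y = app (phi_f r) y'" using y by (auto simp: W_def)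
        then show ?thesis
          unfolding W_def using arg_cong[OF kappa_phi_f[of c r], of "\<lambda>F. app F y'"]
          by (intro image_eqI[of _ _ "app (\<kappa> c) y'"]) (simp_all add: subspace_scale[OF sU])
      qed
    qed
    have "W \<subseteq> U" using U r by (auto simp: W_def P_def)
    have "app (phi_f q) y \<in> W" if q: "q \<ge> 1" and y: "y \<in> W" for q y
    proof -
      obtain w where w: "w \<in> U" "y = app (phi_f r) w" using y by (auto simp: W_def)
      have "app (phi_f q) y = app (phi_f r) (- app (phi_f q) w)"
        using arg_cong[OF phi_f_anti[OF r q], of "\<lambda>F. app F w"] w by simp
      moreover have "- app (phi_f q) w \<in> U"
        using U w q by (auto simp: P_def subspace_neg)
      ultimately show ?thesis unfolding W_def by (rule image_eqI)
    qed
    moreover have "W \<noteq> {0}" using nz x by (auto simp: W_def)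
    ultimately have "P W" using sW by (auto simp: P_def)
    have "W \<noteq> U"
    proof
      assume "W = U"
      then obtain y where y: "y \<in> U" "x = app (phi_f r) y" using x by (auto simp: W_def)
      then show False using nz arg_cong[OF phi_f_square[OF r], of "\<lambda>F. app F y"] by simp
    qed
    then have "dim W < dim U"
      using \<open>W \<subseteq> U\<close> sW sU by (intro dim_psubset) (simp only: span_eq_iff[THEN iffD2] psubset_eq simp_thms)
    then show False using min[OF \<open>P W\<close>] by simp
  qed
  moreover obtain x where "x \<in> U" "x \<noteq> 0" using U0 subspace_0[OF sU] by blast
  ultimately show ?thesis by blast
qed

text \<open>The common kernel is nonzero, and it is stable under \<open>e1\<close> and
  \<open>f $ Suc 0\<close> because these anticommute with every \<open>phi_f r\<close>.\<close>

lemma phi_f_zero: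
  assumes "r \<ge> 1"
  shows "phi_f r = 0"
proof -
  obtain x where x: "x \<noteq> 0" "\<forall>r\<ge>1. app (phi_f r) x = 0"
    using phi_f_common_kernel by blast
  show ?thesis
  proof (rule kernel_trivial[of "phi_f ` {1..}" x])
    fix F assume "F \<in> phi_f ` {1..}"
    then obtain r where F: "F = phi_f r" "r \<ge> 1" by auto
    show "\<exists>a. par a F"
      unfolding F phi_f_def by (intro exI[of _ 1] par_sum par_scale par_f)
    show "\<kappa> c * F = F * \<kappa> c" for c
      by (simp add: F kappa_phi_f)
    show "app F x = 0" using x F by simp
  next
    fix y P F
    assume y: "\<And>F. F \<in> phi_f ` {1..} \<Longrightarrow> app F y = 0"
      and P: "P \<in> insert e1 (insert (f $ Suc 0) (range (fps_nth d)))" and "F \<in> phi_f ` {1..}"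
    then obtain r where F: "F = phi_f r" "r \<ge> 1" by auto
    have y: "app (phi_f r) y = 0" if "r \<ge> 1" for r using y that by auto
    \<comment> \<open>All \<open>r\<close> are treated at once: moving past \<open>d $ Suc n\<close>
      brings in \<open>phi_f (Suc r)\<close> together with \<open>d $ n\<close>.\<close>
    have "app (phi_f r) (app (d $ n) y) = 0" for n
      using F(2)
    proof (induction n arbitrary: r)
      case 0
      then show ?case using y by (simp add: T0)
    next
      case (Suc n)
      have "phi_f r * d $ Suc n = d $ Suc n * phi_f r - d $ n * phi_f (Suc r) + phi_f (Suc r) * d $ n
        + \<kappa> (of_int s) * (phi_f r * d $ n)"
        using d_phi_f[OF Suc.prems, of n] by (simp add: algebra_simps)
      from arg_cong[OF this, of "\<lambda>F. app F y"] show ?case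
        using y Suc by simp
    qed
    moreover have "app (phi_f r) (app e1 y) = 0"
      using arg_cong[OF phi_f_e1[OF F(2)], of "\<lambda>F. app F y"] y F by simp
    moreover have "app (phi_f r) (app (f $ Suc 0) y) = 0"
      using arg_cong[OF phi_f_f_anti[of "Suc 0" r], of "\<lambda>F. app F y"] y F by simp
    ultimately show "app F (app P y) = 0" using P F by auto
  qed (use x assms in auto)
qed


section \<open>The vector \<open>\<Omega>\<close>: annihilation by \<open>f\<close>, and
  nonvanishing\<close>

definition P :: "'v endo" where "P = prodl (\<lambda>i. f $ i) k"
definition \<Omega> :: 'v where "\<Omega> = app P v"

text \<open>Up to \<open>k\<close> the factor repeats one in \<open>P\<close>; beyond
  \<open>k\<close>, the vanishing of \<open>phi_f (b - k)\<close> with \<open>\<phi>\<close> monic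
  reduces \<open>f $ b\<close> to smaller indices.\<close>

lemma f_P: "f $ b * P = 0"
proof (induction b rule: less_induct)
  case (less b)
  consider "b = 0" | "1 \<le> b" "b \<le> k" | "b > k" by linarith
  then show ?case
  proof cases
    case 2
    then show ?thesis
      unfolding P_def by (intro mult_prodl_zero[where i = b] f_anti f_square_zero)
  next
    case 3
    define r where "r = b - k"
    have r: "r \<ge> 1" "b = k + r" using 3 by (simp_all add: r_def)
    have "phi_f r * P = (\<Sum>j\<le>k. \<kappa> (coeff \<phi> j) * (f $ (j + r) * P))"
      by (simp add: phi_f_def sum_distrib_right mult.assoc)
    also have "\<dots> = (\<Sum>j\<in>{k}. \<kappa> (coeff \<phi> j) * (f $ (j + r) * P))"
      by (rule sum.mono_neutral_right) (use less r in auto)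
    finally show ?thesis using phi_f_zero[OF r(1)] \<phi> by (simp add: kappa_1 r)
  qed simp
qed

lemma f_Omega: "app (f $ b) \<Omega> = 0"
  using arg_cong[OF f_P[of b], of "\<lambda>F. app F v"] by (simp add: \<Omega>_def)

text \<open>Chosen so that its commutator with \<open>f $ n\<close> is exactly
  \<open>f $ Suc n\<close>. By \<open>f_Suc\<close>, \<open>- \<sigma> d_2\<close> contributes
  \<open>f_(n+1) + f_n d_1\<close>; the quadratic term cancels \<open>f_n d_1\<close> and leaves
  half of \<open>\<sigma> f_n\<close>, which the linear term removes.\<close>

definition D :: "'v endo" where
  "D = - (\<kappa> (of_int s) * d $ 2) + \<kappa> (of_int s / 2) * (d $ Suc 0 * d $ Suc 0) + \<kappa> (1 / 2) * d $ Suc 0"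

lemma kappa_diff: "\<kappa> (a - b) = \<kappa> a - \<kappa> b"
  by (simp only: diff_conv_add_uminus kappa_add kappa_minus)

lemma kappa_2: "\<kappa> (1 / 2) * (x + x) = x"
  by (simp add: distrib_left flip: distrib_right kappa_add) (simp add: kappa_1)

lemma kappa_s_sq: "\<kappa> (of_int s) * (\<kappa> (of_int s) * x) = x"
  using sigma_sigma(2) .

lemma D_f:
  assumes "n \<ge> 1"
  shows "D * f $ n = f $ n * D + f $ Suc n"
proof -
  let ?s = "\<kappa> (of_int s)" and ?h = "\<kappa> (1 / 2)" and ?d1 = "d $ Suc 0" and ?F = "f $ n"
  have sh: "\<kappa> (of_int s / 2) = ?h * ?s" by (simp flip: kappa_mult)
  have d1: "?d1 * ?F = ?F * ?d1 - ?s * ?F" using d1_f[OF assms] by simp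
  have Fk: "?F * (\<kappa> c * x) = \<kappa> c * (?F * x)" and dk: "d $ m * (\<kappa> c * x) = \<kappa> c * (d $ m * x)" for c x m
    by (rule mult_left_commuteI, simp only: kappa_f kappa_T)+
  have d1x: "?d1 * (?F * x) = ?F * (?d1 * x) - ?s * (?F * x)" for x
    by (simp only: mult.assoc[symmetric] d1 left_diff_distrib)
  have dd: "?d1 * (?d1 * ?F) = ?F * (?d1 * ?d1) - ?s * (?F * ?d1) - ?s * (?F * ?d1) + ?F"
    by (simp add: d1 d1x right_diff_distrib dk kappa_s_sq)
  have "D * ?F - ?F * D = - (?s * (d $ 2 * ?F - ?F * d $ 2)) + ?h * (?s * (?d1 * (?d1 * ?F) - ?F * (?d1 * ?d1)))
    + ?h * (?d1 * ?F - ?F * ?d1)"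
    by (simp add: D_def sh distrib_left distrib_right right_diff_distrib left_diff_distrib mult.assoc Fk)
  also have "\<dots> = - (?s * (d $ 2 * ?F - ?F * d $ 2)) - ?h * (?F * ?d1 + ?F * ?d1)"
    unfolding dd unfolding d1 by (simp add: right_diff_distrib distrib_left kappa_s_sq)
  also have "\<dots> = f $ Suc n" by (simp only: kappa_2 f_Suc[OF assms])
  finally show ?thesis by (simp add: algebra_simps)
qed

text \<open>Substitutes for the higher coefficients of \<open>e\<close>: each commutator with
  \<open>D\<close> raises by one the index of \<open>H\<close> that results from pairing with
  \<open>f\<close>.\<close>

primrec E :: "nat \<Rightarrow> 'v endo" where
  "E 0 = e1"
| "E (Suc a) = E a * D - D * E a"

lemma kappa_D: "\<kappa> c * D = D * \<kappa> c"
proof -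
  have mult: "\<kappa> c * (F * G) = F * G * \<kappa> c" if "\<kappa> c * F = F * \<kappa> c" "\<kappa> c * G = G * \<kappa> c" for F G
    by (simp only: mult.assoc mult_left_commuteI[OF that(1)] that(2))
  show ?thesis
    unfolding D_def distrib_left distrib_right mult_minus_left mult_minus_right
    by (intro arg_cong2[of _ _ _ _ plus] arg_cong[of _ _ uminus] mult kappa_commute kappa_T)
qed

lemma kappa_E: "\<kappa> c * E a = E a * \<kappa> c"
  by (induction a) (simp_all add: kappa_T left_diff_distrib right_diff_distrib mult.assoc kappa_D
      mult_left_commuteI[of "\<kappa> c"])

text \<open>The commutator with \<open>D\<close> acts as a derivation on the anticommutator, which
  is a scalar and so commutes with \<open>D\<close>; what remains is the pairing of
  \<open>E a\<close> with \<open>f $ Suc b\<close>.\<close>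

lemma E_f: "b \<ge> 1 \<Longrightarrow> E a * f $ b + f $ b * E a = \<kappa> (H $ (a + b))"
proof (induction a arbitrary: b)
  case 0
  then show ?case using e1_f[of b] by simp
next
  case (Suc a)
  have fD: "f $ b * D = D * f $ b - f $ Suc b" using D_f[OF Suc.prems] by simp
  have fDx: "f $ b * (D * x) = D * (f $ b * x) - f $ Suc b * x" for x
    by (simp only: mult.assoc[symmetric] fD left_diff_distrib)
  have "E (Suc a) * f $ b + f $ b * E (Suc a) = (E a * f $ b + f $ b * E a) * D
    - D * (E a * f $ b + f $ b * E a) + (E a * f $ Suc b + f $ Suc b * E a)"
    by (simp add: left_diff_distrib right_diff_distrib distrib_left distrib_right mult.assoc fDx
        D_f[OF Suc.prems])
  then show ?case using Suc.IH[of b] Suc.IH[of "Suc b"] Suc.prems by (simp add: kappa_D)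
qed

lemma E_v: "app (E a) v = 0"
proof (induction a)
  case (Suc a)
  have "\<exists>c. app D v = app (\<kappa> c) v"
  proof
    show "app D v = app (\<kappa> (- (of_int s * \<zeta>1 $ 2) + of_int s / 2 * (\<zeta>1 $ Suc 0 * \<zeta>1 $ Suc 0)
      + 1 / 2 * \<zeta>1 $ Suc 0)) v"
      using arg_cong[OF kappa_T[of "\<zeta>1 $ Suc 0" I1 I1 "Suc 0", symmetric], of "\<lambda>F. app F v"]
      by (simp add: D_def kappa_add kappa_minus kappa_diff d_v)
  qed
  then obtain c where c: "app D v = app (\<kappa> c) v" by blast
  then show ?case
    using Suc arg_cong[OF kappa_E[of c a, symmetric], of "\<lambda>F. app F v"] by simp
qed (use e1_v in simp)

text \<open>A combination \<open>E'\<close> of the \<open>E a\<close> anticommutes with the first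
  \<open>i\<close> factors, pairs to 1 with \<open>f $ Suc i\<close> and kills \<open>v\<close>. It
  therefore maps the longer string back to the shorter one up to sign.\<close>

lemma f_string_nonzero: "i \<le> k \<Longrightarrow> app (prodl (\<lambda>i. f $ i) i) v \<noteq> 0"
proof (induction i)
  case 0
  then show ?case using v by simp
next
  case (Suc i)
  \<comment> \<open>Needed for the numerator of \<open>H\<close>: a common divisor of
    \<open>\<phi>\<close> and \<open>\<psi> - \<phi>\<close> divides \<open>\<psi>\<close>.\<close>
  have "coprime \<phi> (smult (of_int s) (\<psi> - \<phi>))"
  proof (rule coprimeI)
    fix c assume "c dvd \<phi>" "c dvd smult (of_int s) (\<psi> - \<phi>)"
    then have "c dvd \<psi> - \<phi>" using s dvd_minus_iff[of c "\<phi> - \<psi>"] by auto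
    from dvd_add[OF this \<open>c dvd \<phi>\<close>] have "c dvd \<psi>" by simp
    then show "is_unit c" using coprime \<open>c dvd \<phi>\<close> by (auto simp: coprime_def)
  qed
  moreover have "degree (smult (of_int s) (\<psi> - \<phi>)) \<le> k"
    using \<phi> \<psi> by (intro order_trans[OF degree_smult_le]) (auto intro: degree_diff_le)
  ultimately obtain N p where p: "\<And>l. 1 \<le> l \<Longrightarrow> l \<le> k \<Longrightarrow>
      (\<Sum>a\<le>N. p a * H $ (a + l)) = (if l = k then 1 else 0)"
    using homog_quotient_dual[OF H_phi _ \<phi>] by metis
  \<comment> \<open>The shift by \<open>k - Suc i\<close> moves index \<open>Suc i\<close> to
    \<open>k\<close>, where the dual functional takes the value 1.\<close>
  define E' where "E' = (\<Sum>a\<le>N. \<kappa> (p a) * E (a + (k - Suc i)))"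
  have E'f: "E' * f $ l + f $ l * E' = (if l = Suc i then 1 else 0)" if "1 \<le> l" "l \<le> Suc i" for l
  proof -
    have "E' * f $ l + f $ l * E' = (\<Sum>a\<le>N. \<kappa> (p a) * (E (a + (k - Suc i)) * f $ l + f $ l * E (a + (k - Suc i))))"
      by (simp add: E'_def sum_distrib_left sum_distrib_right sum.distrib distrib_left mult.assoc
          mult_left_commuteI[OF kappa_f[symmetric]])
    also have "\<dots> = \<kappa> (\<Sum>a\<le>N. p a * H $ (a + (k - Suc i + l)))"
      using that by (simp add: E_f kappa_sum kappa_mult add.assoc)
    also have "\<dots> = (if l = Suc i then 1 else 0)"
      using p[of "k - Suc i + l"] that Suc.prems by (auto simp: kappa_1)
    finally show ?thesis .
  qed
  have "E' * f $ l = - (f $ l * E')" if "1 \<le> l" "l \<le> i" for l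
    using E'f[of l] that by (simp add: eq_neg_iff_add_eq_0)
  then have "E' * prodl (\<lambda>i. f $ i) i = (- 1) ^ i * (prodl (\<lambda>i. f $ i) i * E')"
    by (rule prodl_anticommute)
  then have "E' * prodl (\<lambda>i. f $ i) (Suc i) = (- 1) ^ i * (prodl (\<lambda>i. f $ i) i * (E' * f $ Suc i))"
    by (simp flip: mult.assoc)
  also have "E' * f $ Suc i = 1 - f $ Suc i * E'" using E'f[of "Suc i"] by (simp add: algebra_simps)
  finally have eq: "E' * prodl (\<lambda>i. f $ i) (Suc i) = (- 1) ^ i * (prodl (\<lambda>i. f $ i) i * (1 - f $ Suc i * E'))" .
  have "app E' v = 0" by (simp add: E'_def app_sum E_v)
  with arg_cong[OF eq, of "\<lambda>F. app F v"] Suc show ?case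
    by (auto simp: app_neg_1_power split: if_splits)
qed

lemma Omega_nonzero: "\<Omega> \<noteq> 0"
  unfolding \<Omega>_def P_def by (rule f_string_nonzero) simp

lemma Omega_homogeneous: "\<exists>a. \<Omega> \<in> V a"
proof -
  have "\<exists>a. par a (prodl (\<lambda>i. f $ i) m)" for m
  proof (induction m)
    case 0
    then show ?case by (intro exI[of _ 0]) (simp add: par_def)
  next
    case (Suc m)
    then obtain a where "par a (prodl (\<lambda>i. f $ i) m)" by blast
    from par_mult[OF this par_f] show ?case unfolding prodl_Suc by blast
  qed
  then show ?thesis using v(2) unfolding \<Omega>_def P_def par_def by blast
qed

section \<open>Action of \<open>d\<close> and \<open>t21\<close> on \<open>\<Omega>\<close>\<close>

definition \<beta> :: "complex fps" where "\<beta> = 1 - fps_const (of_int s) * fps_X"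
definition \<alpha>1 :: "complex fps" where "\<alpha>1 = \<zeta>1 * (homog \<beta> \<phi> k / homog 1 \<phi> k)"

lemma K_homog: "K (homog b p n) = (\<Sum>j\<le>n. fps_const (\<kappa> (coeff p j)) * K b ^ j * fps_X ^ (n - j))"
  by (simp add: homog_def K_sum K_mult K_power)

lemma s_const_commute: "fps_const (\<kappa> (of_int s)) * F = F * fps_const (\<kappa> (of_int s))"
  using sgn by (auto simp flip: fps_const_neg)

lemma K_beta: "K \<beta> = 1 - fps_const (\<kappa> (of_int s)) * fps_X"
  by (simp add: \<beta>_def K_diff K_mult)

lemma K_beta_commute: "K \<beta> * F = F * K \<beta>"
  by (simp only: K_beta left_diff_distrib right_diff_distrib mult.assoc fps_mult_fps_X_commute[of F]
      mult_left_commuteI[OF s_const_commute[of F]] mult_1_left mult_1_right)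

lemma beta_0: "\<beta> $ 0 = 1"
  by (simp add: \<beta>_def)

text \<open>The linear relation required by \<open>prodl_companion\<close> is
  \<open>phi_f 1 = 0\<close>.\<close>

lemma companion:
  assumes "\<And>F. K b * F = F * K b" "b $ 0 = 1"
  shows "prodl (\<lambda>i. K b * fps_const (f $ i) - fps_X * fps_const (f $ Suc i)) k
    = K (homog b \<phi> k) * fps_const P"
proof -
  have "prodl (\<lambda>i. K b * fps_const (f $ i) - fps_X * fps_const (f $ Suc i)) k
    = (\<Sum>j\<le>k. fps_const (\<kappa> (coeff \<phi> j)) * K b ^ j * fps_X ^ (k - j)) * prodl (\<lambda>i. fps_const (f $ i)) k"
  proof (rule prodl_companion)
    show "K (inverse b) * K b = 1"
      using assms(2) by (simp add: inverse_mult_eq_1 flip: K_mult)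
    have "(\<Sum>j\<le>k. fps_const (\<kappa> (coeff \<phi> j)) * fps_const (f $ Suc j)) = fps_const (phi_f 1)"
      by (rule fps_ext) (simp add: fps_sum_nth phi_f_def)
    then show "(\<Sum>j\<le>k. fps_const (\<kappa> (coeff \<phi> j)) * fps_const (f $ Suc j)) = 0"
      using phi_f_zero[of 1] by simp
    show "fps_const (f $ i) * fps_const (f $ j) = - (fps_const (f $ j) * fps_const (f $ i))"
      if "1 \<le> i" "1 \<le> j" for i j
      using f_anti[OF that] by (simp add: fps_const_neg)
    show "fps_const (\<kappa> (coeff \<phi> k)) = 1" using \<phi> by (simp add: kappa_1)
  qed (simp_all only: assms f_square_zero kappa_f fps_const_mult fps_const_0_eq_0 fps_mult_fps_X_commute)
  then show ?thesis by (simp add: K_homog P_def prodl_const)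
qed

text \<open>Conjugation by \<open>d\<close> carries the companion product with parameter
  \<open>1\<close> to the one with parameter \<open>\<beta>\<close>; both are multiples of
  \<open>P\<close>.\<close>

lemma d_P: "K (homog 1 \<phi> k) * d * fps_const P = K (homog \<beta> \<phi> k) * fps_const P * d"
proof -
  let ?F = "\<lambda>i. fps_const (f $ i)"
  have "d * (K 1 * ?F i - fps_X * ?F (Suc i)) = (K \<beta> * ?F i - fps_X * ?F (Suc i)) * d" if "1 \<le> i" for i
    using d_const_f[OF that]
    by (simp add: K_beta left_diff_distrib right_diff_distrib mult.assoc
        mult_left_commuteI[OF fps_mult_fps_X_commute[of d, symmetric]] diff_eq_eq)
  then have "d * prodl (\<lambda>i. K 1 * ?F i - fps_X * ?F (Suc i)) k
    = prodl (\<lambda>i. K \<beta> * ?F i - fps_X * ?F (Suc i)) k * d"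
    by (rule prodl_intertwine)
  then have "d * (K (homog 1 \<phi> k) * fps_const P) = K (homog \<beta> \<phi> k) * fps_const P * d"
    using companion[of 1] companion[of \<beta>] K_beta_commute beta_0 by simp
  then show ?thesis by (simp add: scal_K[OF scal_T] flip: mult.assoc)
qed

lemma scal_P: "scal (fps_const P)"
  unfolding scal_const P_def by (intro allI prodl_commute kappa_f)

lemma alpha1_phi: "homog 1 \<phi> k * \<alpha>1 = \<zeta>1 * homog \<beta> \<phi> k"
proof -
  have "homog 1 \<phi> k * \<alpha>1 = \<zeta>1 * homog \<beta> \<phi> k * (inverse (homog 1 \<phi> k) * homog 1 \<phi> k)"
    using fps_divide_unit[of "homog 1 \<phi> k" "homog \<beta> \<phi> k"] phi_hat_0 by (simp add: \<alpha>1_def mult_ac)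
  then show ?thesis using phi_hat_0 by (simp add: inverse_mult_eq_1)
qed

lemma d_Omega: "ann (d - K \<alpha>1) \<Omega>"
proof -
  have "K (homog 1 \<phi> k) * ((d - K \<alpha>1) * fps_const P)
    = K (homog \<beta> \<phi> k) * fps_const P * d - K (homog 1 \<phi> k * \<alpha>1) * fps_const P"
    by (simp add: left_diff_distrib right_diff_distrib d_P K_mult flip: mult.assoc)
  also have "\<dots> = K (homog \<beta> \<phi> k) * fps_const P * (d - K \<zeta>1)"
    unfolding alpha1_phi by (simp add: right_diff_distrib K_mult mult.assoc scal_K[OF scal_P, symmetric])
      (simp add: mult.commute flip: K_mult mult.assoc)
  finally have 1: "K (homog 1 \<phi> k) * ((d - K \<alpha>1) * fps_const P)
    = K (homog \<beta> \<phi> k) * fps_const P * (d - K \<zeta>1)" .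
  have "(d - K \<alpha>1) * fps_const P = K (inverse (homog 1 \<phi> k)) * (K (homog 1 \<phi> k) * ((d - K \<alpha>1) * fps_const P))"
    using phi_hat_0 by (simp add: inverse_mult_eq_1 flip: K_mult mult.assoc)
  moreover have "ann (d - K \<zeta>1) v" by (simp add: ann_def d_v)
  ultimately have "ann ((d - K \<alpha>1) * fps_const P) v"
    unfolding 1 by (simp add: ann_mult)
  then show ?thesis by (simp add: ann_mult_const \<Omega>_def)
qed

text \<open>\<open>t21 = f * d\<close>, where \<open>d\<close> acts on \<open>\<Omega>\<close> by a
  scalar series and \<open>f\<close> kills \<open>\<Omega>\<close>.\<close>

lemma t21_Omega: "ann t21 \<Omega>"
proof -
  have "t21 = f * (d - K \<alpha>1) + K \<alpha>1 * f"
    by (simp add: scal_K[OF scal_f] right_diff_distrib fd)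
  moreover have "ann f \<Omega>" by (simp add: ann_def f_Omega)
  ultimately show ?thesis using d_Omega by (simp add: ann_add ann_mult)
qed

section \<open>Action of \<open>t22\<close> on \<open>\<Omega>\<close>\<close>

definition \<alpha>2 :: "complex fps" where "\<alpha>2 = \<zeta>2 * (homog \<beta> \<psi> k / homog 1 \<psi> k)"

lemma homog_beta_0: "homog \<beta> p k $ 0 = coeff p k"
proof -
  have "homog \<beta> p k $ 0 = (\<Sum>j\<le>k. if j = k then coeff p j else 0)"
    unfolding homog_def fps_sum_nth
    by (rule sum.cong) (auto simp: fps_power_zeroth beta_0 fps_X_power_nth)
  then show ?thesis by simp
qed

lemma kappa_inj: "app (\<kappa> a) \<Omega> = app (\<kappa> b) \<Omega> \<Longrightarrow> a = b"
  using Omega_nonzero by simp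

lemma d_n_Omega: "app (d $ n) (app (\<kappa> c) \<Omega>) = app (\<kappa> (\<alpha>1 $ n * c)) \<Omega>"
proof -
  have "app (d $ n) \<Omega> = app (\<kappa> (\<alpha>1 $ n)) \<Omega>" using d_Omega by (simp add: ann_def)
  then show ?thesis
    using arg_cong[OF kappa_T[of c I1 I1 n, symmetric], of "\<lambda>F. app F \<Omega>"] by (simp add: mult.commute)
qed

lemma f_e1_Omega: "app (f $ b) (app e1 \<Omega>) = app (\<kappa> (H $ b)) \<Omega>"
  using arg_cong[OF e1_f[of b], of "\<lambda>F. app F \<Omega>"] by (simp add: f_Omega)

text \<open>Induction on the level of \<open>d\<close>: \<open>d_f_coeff\<close> moves
  \<open>f\<close> to the right past \<open>d\<close>, where it meets \<open>e1\<close> and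
  \<open>f_e1_Omega\<close> applies; the other terms have a lower level.\<close>

lemma f_d_e1_Omega:
  "b \<ge> 1 \<Longrightarrow> \<exists>c. app (f $ b) (app (d $ n) (app e1 \<Omega>)) = app (\<kappa> c) \<Omega>"
proof (induction n arbitrary: b)
  case 0
  then show ?case by (simp add: T0 f_e1_Omega)
next
  case (Suc n)
  have eq: "f $ b * d $ Suc n = d $ Suc n * f $ b - d $ n * f $ Suc b + f $ Suc b * d $ n
      + \<kappa> (of_int s) * (f $ b * d $ n)"
    using d_f_coeff[OF Suc.prems, of n] by (simp add: algebra_simps)
  obtain c1 c2 where c: "app (f $ b) (app (d $ n) (app e1 \<Omega>)) = app (\<kappa> c1) \<Omega>"
    "app (f $ Suc b) (app (d $ n) (app e1 \<Omega>)) = app (\<kappa> c2) \<Omega>"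
    using Suc.IH[of b] Suc.IH[of "Suc b"] Suc.prems by auto
  show ?case
    using arg_cong[OF eq, of "\<lambda>F. app F (app e1 \<Omega>)"]
    by (intro exI[of _ "\<alpha>1 $ Suc n * H $ b - \<alpha>1 $ n * H $ Suc b + c2 + of_int s * c1"])
      (simp add: c f_e1_Omega d_n_Omega kappa_diff kappa_add)
qed

lemma t22_Omega: "ann (t22 - K \<alpha>2) \<Omega>"
proof -
  obtain c where c: "\<And>b n. b \<ge> 1 \<Longrightarrow> app (f $ b) (app (d $ n) (app e1 \<Omega>)) = app (\<kappa> (c b n)) \<Omega>"
    using f_d_e1_Omega by metis
  \<comment> \<open>\<open>\<alpha>1 * H $ b\<close> is the value of \<open>d f_b e_1\<close> on
    \<open>\<Omega>\<close>, so \<open>y b\<close> is the eigenvalue of the commutator of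
    \<open>f_b\<close> with \<open>d\<close>, followed on the right by \<open>e_1\<close>.\<close>
  define y where "y b = Abs_fps (c b) - \<alpha>1 * fps_const (H $ b)" for b
  have y_nth: "y b $ n = c b n - \<alpha>1 $ n * H $ b" for b n by (simp add: y_def)
  have "y b $ 0 = 0" if "b \<ge> 1" for b
  proof -
    have "app (\<kappa> (c b 0)) \<Omega> = app (f $ b) (app (d $ 0) (app e1 \<Omega>))" by (rule c[OF that, symmetric])
    also have "\<dots> = app (\<kappa> (H $ b)) \<Omega>" by (simp only: T0 refl if_True app_1 f_e1_Omega)
    finally have "c b 0 = H $ b" by (rule kappa_inj)
    moreover have "1 = \<alpha>1 $ 0"
      using d_n_Omega[of 0 1] by (intro kappa_inj) (simp only: T0 refl if_True app_1 mult_1_right)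
    ultimately show ?thesis by (simp add: y_nth)
  qed
  moreover have "y b $ Suc m = y (Suc b) $ m + of_int s * c b m" if "b \<ge> 1" for b m
  proof -
    have "app (\<kappa> (\<alpha>1 $ Suc m * H $ b - c b (Suc m) - (\<alpha>1 $ m * H $ Suc b - c (Suc b) m))) \<Omega>
      = app (\<kappa> (- (of_int s * c b m))) \<Omega>"
      using arg_cong[OF d_f_coeff[OF that, of m], of "\<lambda>F. app F (app e1 \<Omega>)"] that
      by (simp add: c f_e1_Omega d_n_Omega kappa_diff kappa_minus)
    from kappa_inj[OF this] show ?thesis by (simp add: y_nth algebra_simps)
  qed
  \<comment> \<open>Writing \<open>c b m\<close> as \<open>y b $ m + \<alpha>1 $ m * H $ b\<close>
    and collecting the terms in \<open>y b\<close> on the left produces the factor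
    \<open>\<beta>\<close>.\<close>
  ultimately have step: "\<beta> * y b = fps_X * y (Suc b) + fps_const (of_int s) * \<alpha>1 * fps_X * fps_const (H $ b)"
    if "b \<ge> 1" for b
  proof (intro fps_ext)
    fix n
    show "(\<beta> * y b) $ n = (fps_X * y (Suc b) + fps_const (of_int s) * \<alpha>1 * fps_X * fps_const (H $ b)) $ n"
      using \<open>b \<ge> 1 \<Longrightarrow> y b $ 0 = 0\<close> \<open>b \<ge> 1 \<Longrightarrow> y b $ Suc (n - 1) = y (Suc b) $ (n - 1) + of_int s * c b (n - 1)\<close> that
      by (cases n) (simp_all add: \<beta>_def left_diff_distrib mult.assoc y_nth algebra_simps)
  qed
  \<comment> \<open>Both parts of \<open>y\<close> satisfy the relation: the one with
    \<open>c\<close> by \<open>phi_f 1 = 0\<close>, the one with \<open>H\<close> by its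
    recurrence.\<close>
  have rec: "(\<Sum>j\<le>k. fps_const (coeff \<phi> j) * y (Suc j)) = 0"
  proof (rule fps_ext)
    fix n
    have "app (\<kappa> (\<Sum>j\<le>k. coeff \<phi> j * c (Suc j) n)) \<Omega> = app (phi_f 1) (app (d $ n) (app e1 \<Omega>))"
      by (simp add: phi_f_def app_sum c kappa_sum)
    also have "\<dots> = app (\<kappa> 0) \<Omega>" using phi_f_zero[of 1] by simp
    finally have 1: "(\<Sum>j\<le>k. coeff \<phi> j * c (Suc j) n) = 0" by (rule kappa_inj)
    have 2: "(\<Sum>j\<le>k. coeff \<phi> j * H $ Suc j) = 0"
      using homog_quotient_recurrence[OF H_phi, of 1] by simp
    have "(\<Sum>j\<le>k. coeff \<phi> j * y (Suc j) $ n)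
      = (\<Sum>j\<le>k. coeff \<phi> j * c (Suc j) n) - \<alpha>1 $ n * (\<Sum>j\<le>k. coeff \<phi> j * H $ Suc j)"
      by (simp add: y_nth right_diff_distrib sum_subtractf sum_distrib_left mult.left_commute)
    then show "(\<Sum>j\<le>k. fps_const (coeff \<phi> j) * y (Suc j)) $ n = 0 $ n"
      by (simp add: fps_sum_nth 1 2)
  qed
  have ss: "fps_const (of_int s) * (fps_const (of_int s) * x) = (x :: complex fps)" for x
    using s by (auto simp flip: mult.assoc)
  \<comment> \<open>The numerator of \<open>H\<close> and the factor in \<open>step\<close> both
    carry the sign \<open>s_1\<close>, so the signs cancel.\<close>
  have "homog \<beta> \<phi> k * y 1 = fps_const (of_int s) * \<alpha>1 * homog \<beta> (smult (of_int s) (\<psi> - \<phi>)) k"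
    by (rule homog_quotient_evaluate[OF H_phi H_0 step rec])
  also have "\<dots> = fps_const (of_int s) * (fps_const (of_int s) * (\<alpha>1 * (homog \<beta> \<psi> k - homog \<beta> \<phi> k)))"
    unfolding homog_smult homog_diff by (simp only: mult_ac)
  finally have hy: "homog \<beta> \<phi> k * (\<alpha>1 + y 1) = \<alpha>1 * homog \<beta> \<psi> k"
    unfolding ss by (simp add: algebra_simps)
  \<comment> \<open>Substitute \<open>alpha1_phi\<close> and \<open>zeta\<close>, all with
    denominators cleared, and cancel series with constant term 1.\<close>
  have "(homog \<beta> \<phi> k * homog 1 \<phi> k) * ((\<alpha>1 + y 1) * homog 1 \<psi> k)
    = homog 1 \<phi> k * homog 1 \<psi> k * (homog \<beta> \<phi> k * (\<alpha>1 + y 1))"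
    by (simp only: mult_ac)
  also have "\<dots> = homog 1 \<psi> k * homog \<beta> \<psi> k * (homog 1 \<phi> k * \<alpha>1)"
    unfolding hy by (simp only: mult_ac)
  also have "\<dots> = homog \<beta> \<psi> k * homog \<beta> \<phi> k * (\<zeta>1 * homog 1 \<psi> k)"
    unfolding alpha1_phi by (simp only: mult_ac)
  also have "\<dots> = (homog \<beta> \<phi> k * homog 1 \<phi> k) * (\<zeta>2 * homog \<beta> \<psi> k)"
    unfolding zeta by (simp only: mult_ac)
  finally have "(\<alpha>1 + y 1) * homog 1 \<psi> k = \<zeta>2 * homog \<beta> \<psi> k"
  proof (rule mult_left_cancel[THEN iffD1, rotated])
    have "(homog \<beta> \<phi> k * homog 1 \<phi> k) $ 0 = 1" using \<phi> by (simp add: homog_beta_0 phi_hat_0)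
    then show "homog \<beta> \<phi> k * homog 1 \<phi> k \<noteq> 0" by auto
  qed
  also have "\<dots> = \<alpha>2 * homog 1 \<psi> k"
  proof -
    have "\<alpha>2 * homog 1 \<psi> k = \<zeta>2 * homog \<beta> \<psi> k * (inverse (homog 1 \<psi> k) * homog 1 \<psi> k)"
      using fps_divide_unit[of "homog 1 \<psi> k" "homog \<beta> \<psi> k"] psi_hat_0 by (simp add: \<alpha>2_def mult_ac)
    then show ?thesis using psi_hat_0 by (simp add: inverse_mult_eq_1)
  qed
  finally have \<alpha>2: "\<alpha>1 + y 1 = \<alpha>2"
    using psi_hat_0 by (metis fps_zero_nth mult_right_cancel zero_neq_one)
  have "app (t22 $ n) \<Omega> = app (\<kappa> ((\<alpha>1 + y 1) $ n)) \<Omega>" for n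
  proof -
    \<comment> \<open>\<open>t21_eq\<close> turns \<open>\<sigma> t_21\<close> into the commutator
      of \<open>f_1\<close> with \<open>d\<close>. On \<open>\<Omega>\<close> the term
      \<open>e1 * t21 $ n\<close> vanishes and the commutator term contributes
      \<open>y 1\<close>.\<close>
    have "t22 $ n = d $ n + \<kappa> (of_int s) * (e1 * t21 $ n) + \<kappa> (of_int s) * t21 $ n * e1"
      using arg_cong[OF cross[of n], of "\<lambda>x. d $ n + \<kappa> (of_int s) * x"] by (simp add: distrib_left mult.assoc add.assoc)
    also have "\<kappa> (of_int s) * t21 $ n = f $ Suc 0 * d $ n - d $ n * f $ Suc 0"
      using t21_eq[of n] f1 by (metis minus_diff_eq minus_minus)
    finally have eq: "t22 $ n = d $ n + \<kappa> (of_int s) * (e1 * t21 $ n)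
      + (f $ Suc 0 * d $ n - d $ n * f $ Suc 0) * e1" .
    have "app (t21 $ n) \<Omega> = 0" using t21_Omega by (simp add: ann_def)
    moreover have "app (d $ n) \<Omega> = app (\<kappa> (\<alpha>1 $ n)) \<Omega>" using d_n_Omega[of n 1] by (simp add: kappa_1)
    moreover have "app (f $ Suc 0) (app (d $ n) (app e1 \<Omega>)) = app (\<kappa> (c 1 n)) \<Omega>"
      using c[of 1 n] by simp
    ultimately show ?thesis
      using arg_cong[OF eq, of "\<lambda>F. app F \<Omega>"]
      by (simp add: f_e1_Omega d_n_Omega y_nth kappa_add kappa_diff)
  qed
  then have "app (t22 $ n) \<Omega> = app (\<kappa> (\<alpha>2 $ n)) \<Omega>" for n unfolding \<alpha>2 .
  then show ?thesis by (simp add: ann_def)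
qed

end


section \<open>The representation attached to a module\<close>

lemma scalar_add: "scalar (a + b) = scalar a + scalar b"
  by (simp add: scalar_def single_add)

lemma scalar_mult: "scalar (a * b) = scalar a * scalar b"
  by (simp add: scalar_def mult_single)

lemma scalar_1: "scalar 1 = 1"
  by (simp add: scalar_def)

lemma scalar_commute: "scalar c * x = x * scalar c"
  by (induction x rule: opp_free_induct)
    (simp_all add: distrib_left distrib_right scalar_def mult_single mult.commute)

lemma free_generated:
  assumes "\<And>x y. Q x \<Longrightarrow> Q y \<Longrightarrow> Q (x + y)" "\<And>x y. Q x \<Longrightarrow> Q y \<Longrightarrow> Q (x * y)"
    and "\<And>c. Q (scalar c)" "\<And>i j n. Q (gen i j n)"
  shows "Q x"
proof (induction x rule: opp_free_induct)
  case (single w c)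
  obtain l where w: "w = Word l" by (cases w)
  have "Q (Poly_Mapping.single (Word l) c)"
  proof (induction l)
    case Nil
    then show ?case using assms(3)[of c] by (simp add: scalar_def zero_word_def)
  next
    case (Cons a l)
    obtain i j n where "a = Gen i j n" by (cases a)
    then have "Poly_Mapping.single (Word (a # l)) c = gen i j n * Poly_Mapping.single (Word l) c"
      by (simp add: gen_def mult_single plus_word_def)
    then show ?case using assms(2,4) Cons by simp
  qed
  then show ?case by (simp add: w)
qed (rule assms(1))

lemma relator_eq_0: "cls s (relator s i j k l p q) = cls s 0"
proof -
  interpret I: ideal "rel_ideal s" free_ring by (rule ideal_rel_ideal)
  let ?r = "relator s i j k l p q"
  have r: "?r \<in> rel_ideal s"
    unfolding rel_ideal_def
    by (rule subsetD[OF I.genideal_self]) (simp add: free_ring_def, unfold relators_def, blast)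
  have add: "x + y \<in> rel_ideal s" if "x \<in> rel_ideal s" "y \<in> rel_ideal s" for x y
    using additive_subgroup.a_closed[OF I.additive_subgroup_axioms that] by (simp add: free_ring_def)
  have neg: "- ?r \<in> rel_ideal s"
    using I.I_l_closed[OF r, of "- 1"] by (simp add: free_ring_def)
  have "x - ?r \<in> rel_ideal s" if "x \<in> rel_ideal s" for x
    using add[OF that neg] by simp
  then have "\<exists>z. x = z + ?r \<and> z \<in> rel_ideal s" if "x \<in> rel_ideal s" for x
    using that by (intro exI[of _ "x - ?r"]) simp
  then show ?thesis using add[OF _ r] by (auto simp: cls_eq)
qed

lemma foldr_app: "foldr (\<lambda>r. app (F r)) xs x = app (prod_list (map F xs)) x"
  by (induction xs) simp_all

locale nontrivial_yangian_module =
  fixes s :: "int \<times> int" and M :: "'v::ab_group_add ymod" and x0 :: 'v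
  assumes s: "s \<in> S11" and mod: "yangian_module s M" and x0: "x0 \<noteq> 0"
begin

definition rep :: "free \<Rightarrow> 'v endo" where
  "rep x = Endo (ym_act M (cls s x))"

lemma linear_act: "Vector_Spaces.linear (ym_scale M) (ym_scale M) (ym_act M (cls s x))"
proof -
  have "cls s x \<in> carrier (yangian s)" by (simp add: carrier_yangian)
  then show ?thesis
    using mod ring_hom_closed[of "ym_act M" "yangian s" "end_ring (ym_scale M)" "cls s x"]
    by (simp add: yangian_module_def end_ring_def)
qed

lemma app_rep: "app (rep x) = ym_act M (cls s x)"
  unfolding rep_def by (rule app_Endo) (use linear_act in \<open>simp add: Vector_Spaces.linear_iff\<close>)

lemma rep_add: "rep (x + y) = rep x + rep y"
  using mod ring_hom_add[of "ym_act M" "yangian s" "end_ring (ym_scale M)" "cls s x" "cls s y"]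
  by (intro endo_eqI[OF x0]) (simp add: app_rep yangian_module_def carrier_yangian cls_add end_ring_def)

lemma rep_mult: "rep (x * y) = rep x * rep y"
  using mod ring_hom_mult[of "ym_act M" "yangian s" "end_ring (ym_scale M)" "cls s x" "cls s y"]
  by (intro endo_eqI[OF x0]) (simp add: app_rep yangian_module_def carrier_yangian cls_mult end_ring_def)

lemma rep_1: "rep 1 = 1"
  using mod ring_hom_one[of "ym_act M" "yangian s" "end_ring (ym_scale M)"]
  by (intro endo_eqI[OF x0]) (simp add: app_rep yangian_module_def cls_one end_ring_def)

lemma rep_0: "rep 0 = 0"
  using rep_add[of 0 0] by simp

lemma rep_uminus: "rep (- x) = - rep x"
  using rep_add[of x "- x"] by (simp add: rep_0 eq_neg_iff_add_eq_0 add.commute)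

lemma rep_diff: "rep (x - y) = rep x - rep y"
  using rep_add[of x "- y"] by (simp add: rep_uminus)

lemma rep_sum: "rep (sum F A) = (\<Sum>i\<in>A. rep (F i))"
  by (induction A rule: infinite_finite_induct) (simp_all add: rep_0 rep_add)

lemma rep_relator: "rep (relator s i j k l p q) = 0"
  using rep_0 by (simp add: rep_def relator_eq_0)

lemma app_rep_scalar: "app (rep (scalar c)) = ym_scale M c"
  using mod by (simp add: app_rep yangian_module_def)

lemma rep_scalar_of_int: "rep (scalar (of_int n)) = of_int n"
proof -
  have "rep (scalar (of_nat m)) = of_nat m" for m
    by (induction m) (simp_all add: scalar_add rep_add scalar_1 rep_1, simp add: scalar_def rep_0)
  then show ?thesis
    by (cases n rule: int_cases2)
      (simp_all add: scalar_def single_uminus rep_uminus)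
qed

definition rmap :: "free fps \<Rightarrow> 'v endo fps" where
  "rmap F = Abs_fps (\<lambda>n. rep (F $ n))"

definition T :: "idx \<Rightarrow> idx \<Rightarrow> 'v endo fps" where
  "T i j = rmap (t_series i j)"

lemma rmap_nth [simp]: "rmap F $ n = rep (F $ n)"
  by (simp add: rmap_def)

lemma rmap_mult: "rmap (F * G) = rmap F * rmap G"
  by (rule fps_ext) (simp add: fps_mult_nth rep_sum rep_mult)

lemma rmap_diff: "rmap (F - G) = rmap F - rmap G"
  by (rule fps_ext) (simp add: rep_diff)

lemma rep_sign: "rep (sign a) = sign a"
  by (simp add: sign_def rep_1 rep_uminus)

lemma relation:
  "T i j $ Suc p * T k l $ q - sign ((par s i + par s j) * (par s k + par s l)) * (T k l $ q * T i j $ Suc p)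
   - (T i j $ p * T k l $ Suc q - sign ((par s i + par s j) * (par s k + par s l)) * (T k l $ Suc q * T i j $ p))
   = sign (par s i * par s j + par s i * par s k + par s j * par s k) * (T k j $ p * T i l $ q - T k j $ q * T i l $ p)"
  using rep_relator[of i j k l p q]
  by (simp only: relator_def scomm_def rep_diff rep_mult T_def rmap_nth rep_sign right_minus_eq)

lemma T_0: "T i j $ 0 = (if i = j then 1 else 0)"
  by (simp add: T_def t_series_def rep_1 rep_0)

lemma gl11: "gl11 T (rep (scalar (of_int (fst s))))"
proof
  \<comment> \<open>The two parities differ, and \<open>fst s\<close> is the sign of the first
    index; this makes all signs in \<open>relation\<close> explicit.\<close>
  have s': "fst s = 1 \<and> par s I1 = 0 \<and> par s I2 = 1 \<or> fst s = -1 \<and> par s I1 = 1 \<and> par s I2 = 0"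
    using s by (auto simp: S11_def par_def)
  have \<sigma>: "rep (scalar (of_int (fst s))) = of_int (fst s)" by (rule rep_scalar_of_int)
  show "rep (scalar (of_int (fst s))) = 1 \<or> rep (scalar (of_int (fst s))) = -1"
    using s' unfolding \<sigma> by auto
  have half: "x = 0" if "x + x = 0" for x :: "'v endo"
  proof -
    have "x = rep (scalar (1 / 2 + 1 / 2)) * x" by (simp add: scalar_1 rep_1)
    also have "\<dots> = rep (scalar (1 / 2)) * (x + x)"
      by (simp only: scalar_add rep_add distrib_left distrib_right)
    finally show ?thesis using that by simp
  qed
  show "x = 0" if "x + x = 0" for x :: "'v endo" using half[OF that] .
  show "T i j $ 0 = (if i = j then 1 else 0)" for i j by (rule T_0)
  show "T I1 I1 $ Suc p * T k l $ q - T k l $ q * T I1 I1 $ Suc p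
      - (T I1 I1 $ p * T k l $ Suc q - T k l $ Suc q * T I1 I1 $ p)
      = rep (scalar (of_int (fst s))) * (T k I1 $ p * T I1 l $ q - T k I1 $ q * T I1 l $ p)" for k l p q
    using relation[of I1 I1 p k l q] s' unfolding \<sigma>
    by (cases k; cases l) (auto simp: sign_def)
  \<comment> \<open>The supercommutator of an odd element with itself is twice its square; on the
    right every term contains the vanishing level zero of this current.\<close>
  show "T I1 I2 $ Suc 0 * T I1 I2 $ Suc 0 = 0"
    by (rule half) (use relation[of I1 I2 0 I1 I2 1] s' in \<open>auto simp: sign_def T_0 eq_neg_iff_add_eq_0\<close>)
  show "T I2 I1 $ Suc 0 * T I2 I1 $ Suc 0 = 0"
    by (rule half) (use relation[of I2 I1 0 I2 I1 1] s' in \<open>auto simp: sign_def T_0 eq_neg_iff_add_eq_0\<close>)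
  show "T I1 I2 $ Suc 0 * T I2 I1 $ n + T I2 I1 $ n * T I1 I2 $ Suc 0
    = rep (scalar (of_int (fst s))) * (T I2 I2 $ n - T I1 I1 $ n)" for n
    using relation[of I1 I2 0 I2 I1 n] s' unfolding \<sigma>
    by (auto simp: sign_def T_0)
qed

sublocale gl11 T "rep (scalar (of_int (fst s)))" by (rule gl11)

lemma rmap_d1: "rmap d1_series = d"
  by (simp add: d1_series_def T_def)

lemma rmap_f: "rmap f_series = f"
proof -
  have "rmap f_series * d = t21"
    unfolding rmap_d1[symmetric] rmap_mult[symmetric] gauss_decomposition(3)[symmetric]
    by (simp only: T_def)
  then have "rmap f_series * (d * g) = f" by (simp add: f_def flip: mult.assoc)
  then show ?thesis by (simp add: dg)
qed

lemma rmap_t12: "t12 = d * rmap e_series"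
  unfolding rmap_d1[symmetric] rmap_mult[symmetric] gauss_decomposition(2)[symmetric]
  by (simp only: T_def)

lemma rmap_d2: "rmap d2_series = d2"
  by (simp add: d2_series_def rmap_diff rmap_mult rmap_f rmap_d1 d2_def mult.assoc flip: rmap_t12)
    (simp add: T_def)

lemma par_s: "par s i + par s j = (if i = j then 0 else 1)"
  using s by (cases i; cases j) (auto simp: S11_def par_def)

lemma rep_part:
  assumes "x \<in> ym_part M a"
  shows "app (T i j $ n) x \<in> ym_part M (if i = j then a else a + 1)"
proof (cases n)
  case 0
  have "module.subspace (ym_scale M) (ym_part M b)" for b
    using mod by (auto simp: yangian_module_def z2_grading_def)
  moreover have "module (ym_scale M)"
    using mod by (simp add: yangian_module_def vector_space_def module_def)
  ultimately have "0 \<in> ym_part M b" for b by (rule module.subspace_0[rotated])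
  then show ?thesis using 0 assms by (simp add: T_0)
next
  case (Suc m)
  have "gen i j m \<in> free_part s (par s i + par s j)"
    by (simp add: free_part_def gen_def word_par_def)
  then have "cls s (gen i j m) \<in> yangian_part s (par s i + par s j)"
    by (simp add: yangian_part_def)
  then have "ym_act M (cls s (gen i j m)) x \<in> ym_part M (par s i + par s j + a)"
    using mod assms unfolding yangian_module_def by blast
  moreover have "par s i + par s j + a = (if i = j then a else a + 1)"
    unfolding par_s by (cases a) simp_all
  ultimately have "ym_act M (cls s (gen i j m)) x \<in> ym_part M (if i = j then a else a + 1)"
    by (simp only:)
  then show ?thesis by (simp add: T_def t_series_def Suc app_rep)
qed

lemma closed_rep:
  assumes "module.subspace (ym_scale M) W" "\<And>i j n x. x \<in> W \<Longrightarrow> app (T i j $ n) x \<in> W" "y \<in> W"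
  shows "app (rep x) y \<in> W"
proof -
  have m: "module (ym_scale M)"
    using mod by (simp add: yangian_module_def vector_space_def module_def)
  have "\<forall>y\<in>W. app (rep x) y \<in> W"
  proof (induction x rule: free_generated)
    case (4 i j n)
    show ?case using assms(2)[of _ i j "Suc n"] by (simp add: T_def t_series_def)
  qed (auto simp: rep_add rep_mult app_rep_scalar module.subspace_add[OF m assms(1)] module.subspace_scale[OF m assms(1)])
  then show ?thesis using assms(3) by blast
qed

section \<open>The action transported along the isomorphism of the two super Yangians\<close>

definition rmap' :: "free fps \<Rightarrow> 'v endo fps" where
  "rmap' F = Abs_fps (\<lambda>n. rep (opp_free (F $ n)))"

lemma rmap'_nth [simp]: "rmap' F $ n = rep (opp_free (F $ n))"
  by (simp add: rmap'_def)

lemma opp_free_sum': "opp_free (sum F A) = (\<Sum>i\<in>A. opp_free (F i))"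
  by (induction A rule: infinite_finite_induct) (simp_all add: opp_free_add)

lemma rmap'_mult: "rmap' (F * G) = rmap' F * rmap' G"
  by (rule fps_ext) (simp add: fps_mult_nth opp_free_sum' rep_sum rep_mult opp_free_mult)

lemma rmap'_diff: "rmap' (F - G) = rmap' F - rmap' G"
  by (rule fps_ext) (simp add: rep_diff opp_free_diff)

lemma rmap'_t: "rmap' (t_series i j) = T (opp i) (opp j)"
  by (rule fps_ext) (simp add: T_def opp_free_t_coeff)

lemma tilde_act: "ym_act (tilde_module M) (cls (tilde s) x) = app (rep (opp_free x))"
  by (simp add: tilde_module_def yangian_iso_cls app_rep)

end

theorem theorem4p3:
  fixes s :: "int \<times> int"
    and M :: "('v::ab_group_add) ymod"
    and \<zeta>1 \<zeta>2 :: "complex fps"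
    and v :: 'v
    and \<phi> \<psi> :: "complex poly"
    and k :: nat
  assumes "s \<in> S11"
    and "fps_nth \<zeta>1 0 = 1" and "fps_nth \<zeta>2 0 = 1"
    and "irreducible_module s M"
    and "highest_lweight_vector s M \<zeta>1 \<zeta>2 v"
    and "generated_by s M v"
    and "finite_dim M"
    and "lead_coeff \<phi> = 1" and "lead_coeff \<psi> = 1"
    and "degree \<phi> = k" and "degree \<psi> = k"
    and "coprime \<phi> \<psi>"
    and "\<zeta>1 / \<zeta>2 = expand_at_infinity \<phi> \<psi>"
  shows "highest_lweight_vector (tilde s) (tilde_module M)
           (\<zeta>2 * expand_at_infinity (shift_poly (fst s) \<psi>) \<psi>)
           (\<zeta>1 * expand_at_infinity (shift_poly (fst s) \<phi>) \<phi>)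
           (f_string s M k v)"
proof -
  have mod: "yangian_module s M" using assms(4) by (simp add: irreducible_module_def)
  have v: "v \<noteq> 0" "v \<in> ym_part M 0 \<union> ym_part M 1"
    using assms(5) by (simp_all add: highest_lweight_vector_def)
  interpret Y: nontrivial_yangian_module s M v
    using assms(1) mod v(1) by unfold_locales
  have hw: "app (Y.rep (fps_nth e_series r)) v = 0"
    "app (Y.rep (fps_nth d1_series r)) v = ym_scale M (fps_nth \<zeta>1 r) v"
    "app (Y.rep (fps_nth d2_series r)) v = ym_scale M (fps_nth \<zeta>2 r) v" for r
    using assms(5) by (simp_all add: highest_lweight_vector_def Y.app_rep)
  have scale: "(\<lambda>c. app (Y.rep (scalar c))) = ym_scale M"
    by (simp add: Y.app_rep_scalar)
  have vs: "vector_space (ym_scale M)" and gr: "z2_grading (ym_scale M) (ym_part M)"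
    using mod by (simp_all add: yangian_module_def)
  interpret vector_space "ym_scale M" by (rule vs)
  have part: "subspace (ym_part M a)" for a using gr by (simp add: z2_grading_def)
  have zeta: "\<zeta>1 * homog 1 \<psi> k = \<zeta>2 * homog 1 \<phi> k"
  proof -
    have psi: "homog 1 \<psi> k $ 0 = 1" using assms(9,11) by (simp add: homog_1_nth)
    have "\<zeta>1 * homog 1 \<psi> k = \<zeta>2 * (\<zeta>1 / \<zeta>2) * homog 1 \<psi> k"
      using assms(3) fps_divide_unit[of \<zeta>2 \<zeta>1] inverse_mult_eq_1[of \<zeta>2] by (simp add: mult_ac)
    also have "\<zeta>1 / \<zeta>2 = homog 1 \<phi> k * inverse (homog 1 \<psi> k)"
      using psi expand_at_infinity_homog[OF assms(10,11)] fps_divide_unit[of "homog 1 \<psi> k" "homog 1 \<phi> k"]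
      by (simp add: assms(13))
    finally show ?thesis using psi inverse_mult_eq_1[of "homog 1 \<psi> k"] by (simp add: mult.assoc)
  qed
  interpret G: gl11_module Y.T "\<lambda>c. Y.rep (scalar c)" "fst s" "ym_part M" v \<zeta>1 \<zeta>2 \<phi> \<psi> k
  proof (rule gl11_module.intro, rule Y.gl11, rule gl11_module_axioms.intro, unfold scale)
    show "fst s = 1 \<or> fst s = -1" using assms(1) by (auto simp: S11_def)
    show "Y.rep (scalar (a + b)) = Y.rep (scalar a) + Y.rep (scalar b)" for a b
      by (simp add: scalar_add Y.rep_add)
    show "Y.rep (scalar (a * b)) = Y.rep (scalar a) * Y.rep (scalar b)" for a b
      by (simp add: scalar_mult Y.rep_mult)
    show "Y.rep (scalar 1) = 1" by (simp add: scalar_1 Y.rep_1)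
    show "Y.rep (scalar c) * Y.T i j $ n = Y.T i j $ n * Y.rep (scalar c)" for c i j n
      by (simp add: Y.T_def scalar_commute flip: Y.rep_mult)
    show "0 \<in> ym_part M a" for a using subspace_0[OF part] .
    show "x + y \<in> ym_part M a" if "x \<in> ym_part M a" "y \<in> ym_part M a" for a x y
      using subspace_add[OF part that] .
    show "app (Y.rep (scalar c)) x \<in> ym_part M a" if "x \<in> ym_part M a" for a c x
      using subspace_scale[OF part that] by (simp add: Y.app_rep_scalar)
    show "ym_part M 0 \<inter> ym_part M 1 = {0}" using gr by (simp add: z2_grading_def)
    show "\<exists>y\<in>ym_part M 0. \<exists>z\<in>ym_part M 1. x = y + z" for x
      using gr by (simp add: z2_grading_def)
    show "app (Y.T i j $ n) x \<in> ym_part M (if i = j then a else a + 1)"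
      if "x \<in> ym_part M a" for a x i j n by (rule Y.rep_part[OF that])
    show "W = {0} \<or> W = UNIV" if W: "subspace W"
      "\<And>x. x \<in> W \<Longrightarrow> \<exists>y\<in>W \<inter> ym_part M 0. \<exists>z\<in>W \<inter> ym_part M 1. x = y + z"
      "\<And>i j n x. x \<in> W \<Longrightarrow> app (Y.T i j $ n) x \<in> W" for W
    proof -
      have "submodule s M W"
        unfolding submodule_def
        using W(1,2) Y.closed_rep[OF W(1,3)] by (auto simp: carrier_yangian Y.app_rep)
      then show ?thesis using assms(4) by (simp add: irreducible_module_def)
    qed
    show "\<exists>B. finite B \<and> span B = UNIV" using assms(7) by (simp add: finite_dim_def)
    show "v \<noteq> 0" "\<exists>a. v \<in> ym_part M a" using v by auto
    \<comment> \<open>\<open>t_12 = d e\<close>, so \<open>t_12\<close> kills \<open>v\<close> along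
      with \<open>e\<close>.\<close>
    have "ann (Y.rmap e_series) v" by (simp add: ann_def hw)
    then have "ann (Y.T I1 I2) v" unfolding Y.rmap_t12 by (rule ann_mult)
    then show "app (Y.T I1 I2 $ n) v = 0" for n by (simp add: ann_def)
    show "app (Y.T I1 I1 $ n) v = app (Y.rep (scalar (\<zeta>1 $ n))) v" for n
      by (simp add: hw Y.app_rep_scalar flip: Y.rmap_d1)
    show "app (Y.d2 $ n) v = app (Y.rep (scalar (\<zeta>2 $ n))) v" for n
      by (simp add: hw Y.app_rep_scalar flip: Y.rmap_d2)
  qed (fact vs assms zeta)+
  have \<Omega>: "f_string s M k v = G.\<Omega>"
    by (simp add: f_string_def G.\<Omega>_def G.P_def prodl_def Y.rmap_f[symmetric] foldr_app Y.app_rep[symmetric])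
  \<comment> \<open>The isomorphism exchanges the two indices, so the Gauss decomposition now starts
    from \<open>t_22\<close>.\<close>
  have d1: "Y.rmap' d1_series = Y.T I2 I2" and e: "Y.rmap' d1_series * Y.rmap' e_series = Y.T I2 I1"
    and fs: "Y.rmap' f_series * Y.rmap' d1_series = Y.T I1 I2"
    using Y.rmap'_t[of I1 I1] Y.rmap'_t[of I1 I2] Y.rmap'_t[of I2 I1]
    by (simp_all add: gauss_decomposition Y.rmap'_mult)
  have "ann (Y.rmap' e_series) G.\<Omega>"
  proof -
    have "fps_left_inverse (Y.T I2 I2) 1 * Y.T I2 I2 = 1"
      by (rule fps_left_inverse) (simp add: Y.T_0)
    \<comment> \<open>The transported \<open>e\<close> is the inverse of \<open>t_22\<close> times
      \<open>t_21\<close>, and \<open>t_21\<close> kills \<open>\<Omega>\<close>.\<close>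
    then have "Y.rmap' e_series = fps_left_inverse (Y.T I2 I2) 1 * (Y.T I2 I2 * Y.rmap' e_series)"
      by (simp flip: mult.assoc)
    also have "Y.T I2 I2 * Y.rmap' e_series = Y.T I2 I1" using e by (simp only: d1)
    finally show ?thesis using G.t21_Omega by (simp only: ann_mult)
  qed
  moreover have "ann (Y.rmap' d2_series - G.K G.\<alpha>1) G.\<Omega>"
  proof -
    \<comment> \<open>The transported \<open>d_2\<close> differs from \<open>t_11\<close> by a
      multiple of the transported \<open>e\<close>, so it has the eigenvalue of \<open>t_11\<close>
      on \<open>\<Omega>\<close>.\<close>
    have "Y.rmap' d2_series = Y.T I1 I1 - Y.T I1 I2 * Y.rmap' e_series"
      by (simp add: d2_series_def Y.rmap'_diff Y.rmap'_mult Y.rmap'_t fs)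
    then have eq: "Y.rmap' d2_series - G.K G.\<alpha>1 = (Y.T I1 I1 - G.K G.\<alpha>1) - Y.T I1 I2 * Y.rmap' e_series"
      by simp
    show ?thesis unfolding eq by (intro ann_diff ann_mult G.d_Omega \<open>ann (Y.rmap' e_series) G.\<Omega>\<close>)
  qed
  moreover have "ann (Y.rmap' d1_series - G.K G.\<alpha>2) G.\<Omega>"
    using G.t22_Omega by (simp add: d1)
  moreover have "G.\<alpha>1 = \<zeta>1 * expand_at_infinity (shift_poly (fst s) \<phi>) \<phi>"
    "G.\<alpha>2 = \<zeta>2 * expand_at_infinity (shift_poly (fst s) \<psi>) \<psi>"
    unfolding G.\<alpha>1_def G.\<alpha>2_def G.\<beta>_def by (simp_all add: expand_shift assms(10,11))
  moreover have "G.\<Omega> \<in> ym_part M 0 \<union> ym_part M 1"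
  proof -
    obtain a where "G.\<Omega> \<in> ym_part M a" using G.Omega_homogeneous by blast
    then show ?thesis by (cases a) auto
  qed
  moreover have "ym_part (tilde_module M) = ym_part M" "ym_scale (tilde_module M) = ym_scale M"
    by (simp_all add: tilde_module_def)
  ultimately show ?thesis
    using G.Omega_nonzero
    by (simp add: highest_lweight_vector_def Y.tilde_act \<Omega> ann_def Y.app_rep_scalar)
qed

end
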